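(* Let $n \geq 2$ and let $\alpha$ be a product type automorphism of the diagonal $\mathcal{D}_n$, i.e. $\alpha \in \mathrm{Aut}(\mathcal{D}_n)$ with $\alpha(\varphi^k(\mathcal{D}_n^1)) = \varphi^k(\mathcal{D}_n^1)$ for all $k \geq 0$. Then $\alpha$ extends to a (possibly proper) endomorphism of $\mathcal{O}_n$ if and only if the action of $\alpha$ on the algebras $\varphi^k(\mathcal{D}_n^1)$ is eventually identical, i.e. there is $K \geq 0$ such that the permutations $\sigma_k$ of $\{1,\ldots,n\}$ determined by $\alpha(\varphi^k(S_iS_i^* )) = \varphi^k(S_{\sigma_k(i)}S_{\sigma_k(i)}^* )$ satisfy $\sigma_k = \sigma_K$ for all $k \geq K$. In that case, $\alpha$ extends to a permutation automorphism of $\mathcal{O}_n$.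
   Context: For an integer $n \geq 2$, the Cuntz algebra $\mathcal{O}_n$ is the universal unital $C^*$-algebra generated by isometries $S_1,\ldots,S_n$ with $\sum_{i=1}^n S_iS_i^*=1$. Endomorphisms of $\mathcal{O}_n$ are unital $*$-endomorphisms; for a unitary $v \in \mathcal{O}_n$, $\lambda_v$ denotes the endomorphism determined by $\lambda_v(S_i) = vS_i$ (every endomorphism has this form for a unique $v$). An endomorphism is proper if it is not an automorphism. The canonical shift endomorphism is $\varphi(x) = \sum_{i=1}^n S_i x S_i^*$. For $k \geq 1$, $\mathcal{F}_n^k = \mathrm{span}\{S_{\alpha_1}\cdots S_{\alpha_k}S_{\beta_k}^*\cdots S_{\beta_1}^* : 1 \leq \alpha_j,\beta_j \leq n\} \simeq M_{n^k}$, with matrix units $S_\alpha S_\beta^*$ where $S_\alpha = S_{\alpha_1}\cdots S_{\alpha_k}$, $|\alpha|=|\beta|=k$. $\mathcal{D}_n^k = \mathrm{span}\{S_\alpha S_\alpha^* : |\alpha|=k\} \simeq \mathbb{C}^{n^k}$, and the diagonal $\mathcal{D}_n$ is the norm closure of $\bigcup_k \mathcal{D}_n^k$. In particular $\mathcal{D}_n^1 = \mathrm{span}\{S_iS_i^* : 1 \leq i \leq n\}$. A permutation automorphism of $\mathcal{O}_n$ is an automorphism of the form $\lambda_w$ where, for some $k \geq 1$, $w \in \mathcal{F}_n^k$ is a permutation matrix, i.e. $w = \sum_{|\alpha|=k} S_{\sigma(\alpha)}S_\alpha^*$ for a permutation $\sigma$ of the set of multi-indices $\{1,\ldots,n\}^k$.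 *)

theory Defs
  imports "HOL-Analysis.Analysis" "HOL-Algebra.Ring" "HOL-Combinatorics.Permutations"
begin

section \<open>Unital C*-algebras\<close>

class cstar_algebra = real_normed_algebra_1 + banach +
  fixes scaleC :: "complex \<Rightarrow> 'a \<Rightarrow> 'a"  (infixr \<open>*\<^sub>C\<close> 75)
    and star :: "'a \<Rightarrow> 'a"
  assumes scaleC_add_right: "c *\<^sub>C (x + y) = c *\<^sub>C x + c *\<^sub>C y"
    and scaleC_add_left: "(c + d) *\<^sub>C x = c *\<^sub>C x + d *\<^sub>C x"
    and scaleC_scaleC: "c *\<^sub>C (d *\<^sub>C x) = (c * d) *\<^sub>C x"
    and scaleR_scaleC: "r *\<^sub>R x = complex_of_real r *\<^sub>C x"
    and mult_scaleC_left: "(c *\<^sub>C x) * y = c *\<^sub>C (x * y)"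
    and mult_scaleC_right: "x * (c *\<^sub>C y) = c *\<^sub>C (x * y)"
    and norm_scaleC: "norm (c *\<^sub>C x) = cmod c * norm x"
    and star_star: "star (star x) = x"
    and star_add: "star (x + y) = star x + star y"
    and star_scaleC: "star (c *\<^sub>C x) = cnj c *\<^sub>C star x"
    and star_mult: "star (x * y) = star y * star x"
    and cstar_identity: "norm (star x * x) = (norm x)\<^sup>2"

lemma scaleC_one: "1 *\<^sub>C x = (x :: 'a :: cstar_algebra)"
  using scaleR_scaleC[of 1 x] by simp

global_interpretation complex_vector: vector_space "scaleC :: complex \<Rightarrow> 'a \<Rightarrow> 'a :: cstar_algebra"
  defines cspan = complex_vector.span
  by unfold_locales (simp_all add: scaleC_add_right scaleC_add_left scaleC_scaleC scaleC_one)

definition cstar_subalgebra :: "'a::cstar_algebra set \<Rightarrow> bool" where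
  "cstar_subalgebra B \<longleftrightarrow> closed B \<and> 1 \<in> B \<and>
     (\<forall>x\<in>B. \<forall>y\<in>B. x + y \<in> B \<and> x * y \<in> B) \<and>
     (\<forall>c. \<forall>x\<in>B. c *\<^sub>C x \<in> B) \<and> (\<forall>x\<in>B. star x \<in> B)"

definition unital_star_hom_on :: "'a::cstar_algebra set \<Rightarrow> ('a \<Rightarrow> 'a) \<Rightarrow> bool" where
  "unital_star_hom_on B f \<longleftrightarrow> f ` B \<subseteq> B \<and> f 1 = 1 \<and>
     (\<forall>x\<in>B. \<forall>y\<in>B. f (x + y) = f x + f y \<and> f (x * y) = f x * f y) \<and>
     (\<forall>c. \<forall>x\<in>B. f (c *\<^sub>C x) = c *\<^sub>C f x) \<and> (\<forall>x\<in>B. f (star x) = star (f x))"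

definition star_automorphism_on :: "'a::cstar_algebra set \<Rightarrow> ('a \<Rightarrow> 'a) \<Rightarrow> bool" where
  "star_automorphism_on B f \<longleftrightarrow> unital_star_hom_on B f \<and> bij_betw f B B"

abbreviation endomorphism :: "('a::cstar_algebra \<Rightarrow> 'a) \<Rightarrow> bool" where
  "endomorphism \<equiv> unital_star_hom_on UNIV"

abbreviation automorphism :: "('a::cstar_algebra \<Rightarrow> 'a) \<Rightarrow> bool" where
  "automorphism \<equiv> star_automorphism_on UNIV"


section \<open>Unital C*-algebras with an explicit carrier\<close>

text \<open>
  The universal property of the Cuntz algebra quantifies over all unital C*-algebras, which the
  type class cannot do inside a formula. It is therefore stated for C*-algebras given as
  structures on an arbitrary subset of a type.
\<close>

record 'b cstar_struct = "'b ring" +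
  cscale :: "complex \<Rightarrow> 'b \<Rightarrow> 'b"
  cadj :: "'b \<Rightarrow> 'b"
  cnorm :: "'b \<Rightarrow> real"

locale unital_cstar_algebra = ring B for B :: "('b, 'm) cstar_struct_scheme" (structure) +
  assumes one_not_zero: "\<one> \<noteq> \<zero>"
    and cscale_closed: "x \<in> carrier B \<Longrightarrow> cscale B c x \<in> carrier B"
    and cscale_add_right:
      "\<lbrakk>x \<in> carrier B; y \<in> carrier B\<rbrakk> \<Longrightarrow> cscale B c (x \<oplus> y) = cscale B c x \<oplus> cscale B c y"
    and cscale_add_left:
      "x \<in> carrier B \<Longrightarrow> cscale B (c + d) x = cscale B c x \<oplus> cscale B d x"
    and cscale_cscale: "x \<in> carrier B \<Longrightarrow> cscale B c (cscale B d x) = cscale B (c * d) x"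
    and cscale_one: "x \<in> carrier B \<Longrightarrow> cscale B 1 x = x"
    and mult_cscale_left:
      "\<lbrakk>x \<in> carrier B; y \<in> carrier B\<rbrakk> \<Longrightarrow> cscale B c x \<otimes> y = cscale B c (x \<otimes> y)"
    and mult_cscale_right:
      "\<lbrakk>x \<in> carrier B; y \<in> carrier B\<rbrakk> \<Longrightarrow> x \<otimes> cscale B c y = cscale B c (x \<otimes> y)"
    and cadj_closed: "x \<in> carrier B \<Longrightarrow> cadj B x \<in> carrier B"
    and cadj_cadj: "x \<in> carrier B \<Longrightarrow> cadj B (cadj B x) = x"
    and cadj_add: "\<lbrakk>x \<in> carrier B; y \<in> carrier B\<rbrakk> \<Longrightarrow> cadj B (x \<oplus> y) = cadj B x \<oplus> cadj B y"
    and cadj_cscale: "x \<in> carrier B \<Longrightarrow> cadj B (cscale B c x) = cscale B (cnj c) (cadj B x)"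
    and cadj_mult: "\<lbrakk>x \<in> carrier B; y \<in> carrier B\<rbrakk> \<Longrightarrow> cadj B (x \<otimes> y) = cadj B y \<otimes> cadj B x"
    and cnorm_nonneg: "x \<in> carrier B \<Longrightarrow> 0 \<le> cnorm B x"
    and cnorm_eq_zero: "x \<in> carrier B \<Longrightarrow> cnorm B x = 0 \<longleftrightarrow> x = \<zero>"
    and cnorm_triangle:
      "\<lbrakk>x \<in> carrier B; y \<in> carrier B\<rbrakk> \<Longrightarrow> cnorm B (x \<oplus> y) \<le> cnorm B x + cnorm B y"
    and cnorm_cscale: "x \<in> carrier B \<Longrightarrow> cnorm B (cscale B c x) = cmod c * cnorm B x"
    and cnorm_mult:
      "\<lbrakk>x \<in> carrier B; y \<in> carrier B\<rbrakk> \<Longrightarrow> cnorm B (x \<otimes> y) \<le> cnorm B x * cnorm B y"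
    and cnorm_cstar_identity: "x \<in> carrier B \<Longrightarrow> cnorm B (cadj B x \<otimes> x) = (cnorm B x)\<^sup>2"
    and cnorm_complete:
      "\<lbrakk>\<And>m. X m \<in> carrier B;
        \<And>e. e > 0 \<Longrightarrow> \<exists>N. \<forall>k\<ge>N. \<forall>m\<ge>N. cnorm B (X k \<ominus> X m) < e\<rbrakk>
       \<Longrightarrow> \<exists>x\<in>carrier B. (\<lambda>m. cnorm B (X m \<ominus> x)) \<longlonglongrightarrow> 0"

definition type_cstar :: "'a::cstar_algebra cstar_struct" where
  "type_cstar = \<lparr>carrier = UNIV, monoid.mult = (*), one = 1, ring.zero = 0, add = (+),
     cscale = scaleC, cadj = star, cnorm = norm\<rparr>"

lemma type_cstar_simps [simp]:
  "carrier type_cstar = (UNIV :: 'a::cstar_algebra set)"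
  "x \<otimes>\<^bsub>type_cstar\<^esub> y = x * (y :: 'a)"
  "x \<oplus>\<^bsub>type_cstar\<^esub> y = x + (y :: 'a)"
  "\<one>\<^bsub>type_cstar\<^esub> = (1 :: 'a)"
  "\<zero>\<^bsub>type_cstar\<^esub> = (0 :: 'a)"
  "cscale type_cstar = (scaleC :: _ \<Rightarrow> 'a \<Rightarrow> 'a)"
  "cadj type_cstar = (star :: 'a \<Rightarrow> 'a)"
  "cnorm type_cstar = (norm :: 'a \<Rightarrow> real)"
  by (simp_all add: type_cstar_def)

lemma ring_type_cstar: "Ring.ring (type_cstar :: 'a::cstar_algebra cstar_struct)"
proof (rule ringI)
  show "abelian_group (type_cstar :: 'a cstar_struct)"
    by (rule abelian_groupI)
      (auto simp: algebra_simps intro: exI[of _ "- x" for x :: 'a] add.left_inverse)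
  show "Group.monoid (type_cstar :: 'a cstar_struct)"
    by (rule monoidI) (auto simp: algebra_simps)
qed (auto simp: algebra_simps)

lemma minus_type_cstar [simp]: "x \<ominus>\<^bsub>type_cstar\<^esub> y = x - (y :: 'a::cstar_algebra)"
proof -
  interpret R: Ring.ring "type_cstar :: 'a cstar_struct" by (rule ring_type_cstar)
  have "\<ominus>\<^bsub>type_cstar\<^esub> y = - y"
    by (rule R.minus_equality) simp_all
  then show ?thesis
    by (simp add: a_minus_def)
qed

lemma unital_cstar_algebra_type_cstar:
  "unital_cstar_algebra (type_cstar :: 'a::cstar_algebra cstar_struct)"
proof -
  interpret R: Ring.ring "type_cstar :: 'a cstar_struct" by (rule ring_type_cstar)
  show ?thesis
  proof (unfold_locales, goal_cases)
    case (20 X)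
    have "Cauchy X"
      using 20(2) by (simp add: Cauchy_def dist_norm)
    then obtain x where "X \<longlonglongrightarrow> x"
      using Cauchy_convergent_iff convergent_def by blast
    then have "(\<lambda>m. norm (X m - x)) \<longlonglongrightarrow> 0"
      using LIM_zero tendsto_norm_zero by blast
    then show ?case
      by auto
  qed (simp_all add: scaleC_add_right scaleC_add_left scaleC_scaleC scaleC_one mult_scaleC_left
      mult_scaleC_right norm_scaleC star_star star_add star_scaleC star_mult cstar_identity
      norm_triangle_ineq norm_mult_ineq)
qed

definition unital_star_hom_into ::
    "'b cstar_struct \<Rightarrow> ('a::cstar_algebra \<Rightarrow> 'b) \<Rightarrow> bool" where
  "unital_star_hom_into B f \<longleftrightarrow> range f \<subseteq> carrier B \<and> f 1 = \<one>\<^bsub>B\<^esub> \<and>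
     (\<forall>x y. f (x + y) = f x \<oplus>\<^bsub>B\<^esub> f y \<and> f (x * y) = f x \<otimes>\<^bsub>B\<^esub> f y) \<and>
     (\<forall>c x. f (c *\<^sub>C x) = cscale B c (f x)) \<and> (\<forall>x. f (star x) = cadj B (f x))"

definition cuntz_family :: "'b cstar_struct \<Rightarrow> nat \<Rightarrow> (nat \<Rightarrow> 'b) \<Rightarrow> bool" where
  "cuntz_family B n T \<longleftrightarrow>
     (\<forall>i\<in>{1..n}. T i \<in> carrier B \<and> cadj B (T i) \<otimes>\<^bsub>B\<^esub> T i = \<one>\<^bsub>B\<^esub>) \<and>
     finsum B (\<lambda>i. T i \<otimes>\<^bsub>B\<^esub> cadj B (T i)) {1..n} = \<one>\<^bsub>B\<^esub>"


section \<open>The Cuntz algebra\<close>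

text \<open>
  The type \<^typ>\<open>'a\<close> with the elements S 1, ..., S n is the universal unital C*-algebra generated
  by n isometries whose range projections sum to 1. It is enough to test universality on
  C*-algebras whose carrier is a set of elements of \<^typ>\<open>'a\<close>: a Cuntz family in any unital
  C*-algebra generates a separable C*-subalgebra, whose cardinality is at most that of the
  continuum, hence at most that of the nonzero complex vector space \<^typ>\<open>'a\<close>, so an isomorphic
  copy of it lives on a subset of \<^typ>\<open>'a\<close>.
\<close>

definition cuntz_algebra :: "nat \<Rightarrow> (nat \<Rightarrow> 'a::cstar_algebra) \<Rightarrow> bool" where
  "cuntz_algebra n S \<longleftrightarrow>
     (\<forall>i\<in>{1..n}. star (S i) * S i = 1) \<and>
     (\<Sum>i=1..n. S i * star (S i)) = 1 \<and>
     cstar_subalgebra hull (S ` {1..n}) = UNIV \<and>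
     (\<forall>(B :: 'a cstar_struct) T. unital_cstar_algebra B \<and> cuntz_family B n T \<longrightarrow>
        (\<exists>f. unital_star_hom_into B f \<and> (\<forall>i\<in>{1..n}. f (S i) = T i)))"

definition multi_indices :: "nat \<Rightarrow> nat \<Rightarrow> nat list set" where
  "multi_indices n k = {\<mu>. length \<mu> = k \<and> set \<mu> \<subseteq> {1..n}}"

definition word :: "(nat \<Rightarrow> 'a::cstar_algebra) \<Rightarrow> nat list \<Rightarrow> 'a" where
  "word S \<mu> = prod_list (map S \<mu>)"

definition diagonal_level :: "nat \<Rightarrow> (nat \<Rightarrow> 'a::cstar_algebra) \<Rightarrow> nat \<Rightarrow> 'a set" where
  "diagonal_level n S k = cspan {word S \<mu> * star (word S \<mu>) |\<mu>. \<mu> \<in> multi_indices n k}"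

definition diagonal :: "nat \<Rightarrow> (nat \<Rightarrow> 'a::cstar_algebra) \<Rightarrow> 'a set" where
  "diagonal n S = closure (\<Union>k\<in>{1..}. diagonal_level n S k)"

definition shift :: "nat \<Rightarrow> (nat \<Rightarrow> 'a::cstar_algebra) \<Rightarrow> 'a \<Rightarrow> 'a" where
  "shift n S x = (\<Sum>i=1..n. S i * x * star (S i))"

text \<open>The relation ``\<open>f\<close> is the endomorphism \<open>\<lambda>\<^sub>v\<close>''.\<close>

definition is_lambda :: "nat \<Rightarrow> (nat \<Rightarrow> 'a::cstar_algebra) \<Rightarrow> 'a \<Rightarrow> ('a \<Rightarrow> 'a) \<Rightarrow> bool" where
  "is_lambda n S v f \<longleftrightarrow> endomorphism f \<and> (\<forall>i\<in>{1..n}. f (S i) = v * S i)"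

definition permutation_unitary ::
    "nat \<Rightarrow> (nat \<Rightarrow> 'a::cstar_algebra) \<Rightarrow> nat \<Rightarrow> (nat list \<Rightarrow> nat list) \<Rightarrow> 'a" where
  "permutation_unitary n S k \<sigma> = (\<Sum>\<mu>\<in>multi_indices n k. word S (\<sigma> \<mu>) * star (word S \<mu>))"

definition permutation_automorphism ::
    "nat \<Rightarrow> (nat \<Rightarrow> 'a::cstar_algebra) \<Rightarrow> ('a \<Rightarrow> 'a) \<Rightarrow> bool" where
  "permutation_automorphism n S f \<longleftrightarrow> automorphism f \<and>
     (\<exists>k\<ge>1. \<exists>\<sigma>. \<sigma> permutes multi_indices n k \<and> is_lambda n S (permutation_unitary n S k \<sigma>) f)"


section \<open>Product type automorphisms of the diagonal\<close>

definition product_type_automorphism ::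
    "nat \<Rightarrow> (nat \<Rightarrow> 'a::cstar_algebra) \<Rightarrow> ('a \<Rightarrow> 'a) \<Rightarrow> bool" where
  "product_type_automorphism n S \<alpha> \<longleftrightarrow> star_automorphism_on (diagonal n S) \<alpha> \<and>
     (\<forall>k. \<alpha> ` ((shift n S ^^ k) ` diagonal_level n S 1) = (shift n S ^^ k) ` diagonal_level n S 1)"

definition level_permutation ::
    "nat \<Rightarrow> (nat \<Rightarrow> 'a::cstar_algebra) \<Rightarrow> ('a \<Rightarrow> 'a) \<Rightarrow> nat \<Rightarrow> (nat \<Rightarrow> nat) \<Rightarrow> bool" where
  "level_permutation n S \<alpha> k \<sigma> \<longleftrightarrow> \<sigma> permutes {1..n} \<and>
     (\<forall>i\<in>{1..n}. \<alpha> ((shift n S ^^ k) (S i * star (S i))) =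
                   (shift n S ^^ k) (S (\<sigma> i) * star (S (\<sigma> i))))"

definition eventually_identical ::
    "nat \<Rightarrow> (nat \<Rightarrow> 'a::cstar_algebra) \<Rightarrow> ('a \<Rightarrow> 'a) \<Rightarrow> bool" where
  "eventually_identical n S \<alpha> \<longleftrightarrow>
     (\<exists>\<sigma>. (\<forall>k. level_permutation n S \<alpha> k (\<sigma> k)) \<and> (\<exists>K. \<forall>k\<ge>K. \<sigma> k = \<sigma> K))"

definition extends :: "nat \<Rightarrow> (nat \<Rightarrow> 'a::cstar_algebra) \<Rightarrow> ('a \<Rightarrow> 'a) \<Rightarrow> ('a \<Rightarrow> 'a) \<Rightarrow> bool" where
  "extends n S \<alpha> f \<longleftrightarrow> (\<forall>x\<in>diagonal n S. f x = \<alpha> x)"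

end

theory Submission
  imports Defs
begin

text \<open>
  If the permutations \<open>\<sigma>\<^sub>k\<close> equal \<open>\<tau>\<close> for \<open>k \<ge> K\<close>, then \<open>\<alpha>\<close> is the restriction of \<open>Ad u \<circ> \<beta>\<close>, where \<open>\<beta>\<close>
  permutes the generators by \<open>\<tau>\<close> and \<open>u\<close> is the permutation unitary correcting the first \<open>K\<close> letters.
  Conversely, if \<open>\<lambda>\<^sub>v\<close> extends \<open>\<alpha>\<close>, then conjugation by \<open>v\<close> changes the letters at level \<open>k + 1\<close> by
  \<open>\<sigma>\<^bsub>k+1\<^esub> \<circ> \<sigma>\<^sub>k\<inverse>\<close>. Approximate \<open>v\<close> by a combination of elements \<open>S\<^sub>\<mu> S\<^sub>\<nu>\<^sup>*\<close>. Each of them merely translates deep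
  letters by \<open>|\<mu>| - |\<nu>|\<close>, so if \<open>\<sigma>\<^bsub>k+1\<^esub> \<noteq> \<sigma>\<^sub>k\<close> for some large \<open>k\<close>, some cylinder projection is moved by \<open>v\<close> to a
  projection orthogonal to its translates by all these amounts, which contradicts the approximation.
  The spectral theory needed (contractivity of *-homomorphisms, orthogonality of the ranges of the
  isometries) reduces to the binomial series for the square root.
\<close>

section \<open>Elementary facts about C*-algebras\<close>

lemma star_zero [simp]: "star 0 = (0 :: 'a::cstar_algebra)"
  using star_add[of 0 "0 :: 'a"] by simp

lemma star_one [simp]: "star 1 = (1 :: 'a::cstar_algebra)"
  by (metis star_mult star_star mult.left_neutral)

lemma star_minus: "star (- x) = - star (x :: 'a::cstar_algebra)"
  by (metis add_eq_0_iff star_add star_zero)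

lemma star_diff: "star (x - y) = star x - star (y :: 'a::cstar_algebra)"
  using star_add[of x "- y"] by (simp add: star_minus)

lemma star_sum: "star (\<Sum>i\<in>I. g i) = (\<Sum>i\<in>I. star (g i :: 'a::cstar_algebra))"
  by (induction I rule: infinite_finite_induct) (auto simp: star_add)

lemma star_scaleR: "star (r *\<^sub>R x) = r *\<^sub>R star (x :: 'a::cstar_algebra)"
  by (simp add: scaleR_scaleC star_scaleC)

lemma star_power: "star (x ^ k) = star (x :: 'a::cstar_algebra) ^ k"
  by (induction k) (auto simp: star_mult power_commutes)

lemma norm_le_norm_star: "norm x \<le> norm (star (x :: 'a::cstar_algebra))"
proof (cases "x = 0")
  case False
  have "norm x * norm x = norm (star x * x)"
    by (simp add: cstar_identity power2_eq_square)
  also have "\<dots> \<le> norm (star x) * norm x"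
    by (rule norm_mult_ineq)
  finally show ?thesis
    using False by simp
qed simp

lemma norm_star [simp]: "norm (star x) = norm (x :: 'a::cstar_algebra)"
  using norm_le_norm_star[of x] norm_le_norm_star[of "star x"] by (simp add: star_star)

lemma continuous_star: "continuous_on A (star :: 'a::cstar_algebra \<Rightarrow> 'a)"
proof (rule linear_continuous_on)
  show "bounded_linear (star :: 'a \<Rightarrow> 'a)"
    by (rule bounded_linear_intro[where K = 1]) (auto simp: star_add star_scaleR)
qed

lemma continuous_scaleC: "continuous_on A (\<lambda>x :: 'a::cstar_algebra. c *\<^sub>C x)"
proof (rule linear_continuous_on)
  show "bounded_linear (\<lambda>x :: 'a. c *\<^sub>C x)"
    by (rule bounded_linear_intro[where K = "cmod c"])
      (auto simp: scaleC_add_right scaleR_scaleC scaleC_scaleC norm_scaleC mult.commute)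
qed

lemma star_mult_self_eq_0: "star x * x = 0 \<longleftrightarrow> x = (0 :: 'a::cstar_algebra)"
  using cstar_identity[of x] by auto

lemma norm_isometry_mult:
  fixes v :: "'a::cstar_algebra"
  assumes "star v * v = 1"
  shows "norm (v * x) = norm x"
proof -
  have "(norm (v * x))\<^sup>2 = norm (star x * (star v * v) * x)"
    by (simp flip: cstar_identity add: star_mult mult.assoc)
  then show ?thesis
    using assms by (simp add: cstar_identity)
qed

lemma norm_isometry: "star v * v = 1 \<Longrightarrow> norm v = (1 :: real)" for v :: "'a::cstar_algebra"
  using norm_isometry_mult[of v 1] by simp

lemma norm_projection_le_one:
  fixes p :: "'a::cstar_algebra"
  assumes "star p = p" "p * p = p"
  shows "norm p \<le> 1"
proof -
  have "(norm p)\<^sup>2 = norm p"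
    using cstar_identity[of p] assms by simp
  then show ?thesis
    by (metis mult_right_cancel order.refl power2_eq_square mult_1 zero_le_one)
qed

text \<open>This stands in for monotonicity of the norm on positive elements. Commutation gives
  \<open>star v * v = p * p + q * q\<close> for \<open>v = p + \<i> *\<^sub>C q\<close>, and
  \<open>p\<close>, being the real part of \<open>v\<close>, has norm at most
  \<open>norm v\<close>.\<close>

lemma norm_power2_le_commuting:
  fixes p q :: "'a::cstar_algebra"
  assumes "star p = p" "star q = q" "p * q = q * p"
  shows "(norm p)\<^sup>2 \<le> norm (p * p + q * q)"
proof -
  define v where "v = p + \<i> *\<^sub>C q"
  have sv: "star v = p - \<i> *\<^sub>C q"
    by (simp add: v_def star_add star_scaleC assms)
  have "star v * v = p * p + q * q"
    by (simp add: sv) (simp add: v_def algebra_simps mult_scaleC_left mult_scaleC_right scaleC_scaleC assms)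
  then have nv: "(norm v)\<^sup>2 = norm (p * p + q * q)"
    by (metis cstar_identity)
  have "2 *\<^sub>R p = v + star v"
    by (simp add: sv) (simp add: v_def scaleR_2)
  then have "2 * norm p = norm (v + star v)"
    by (metis norm_scaleR abs_numeral)
  also have "\<dots> \<le> 2 * norm v"
    using norm_triangle_ineq[of v "star v"] by simp
  finally have "norm p \<le> norm v"
    by simp
  then show ?thesis
    unfolding nv[symmetric] by (simp add: power_mono)
qed


subsection \<open>C*-subalgebras\<close>

lemma cstar_subalgebraD:
  assumes "cstar_subalgebra B"
  shows "closed B" "1 \<in> B" "x \<in> B \<Longrightarrow> y \<in> B \<Longrightarrow> x + y \<in> B" "x \<in> B \<Longrightarrow> y \<in> B \<Longrightarrow> x * y \<in> B"
    "x \<in> B \<Longrightarrow> c *\<^sub>C x \<in> B" "x \<in> B \<Longrightarrow> star x \<in> B" "0 \<in> B" "x \<in> B \<Longrightarrow> r *\<^sub>R x \<in> B"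
    "x \<in> B \<Longrightarrow> - x \<in> B" "x \<in> B \<Longrightarrow> y \<in> B \<Longrightarrow> x - y \<in> B" "x \<in> B \<Longrightarrow> x ^ k \<in> B"
proof -
  show *: "closed B" "1 \<in> B" "x \<in> B \<Longrightarrow> y \<in> B \<Longrightarrow> x + y \<in> B" "x \<in> B \<Longrightarrow> y \<in> B \<Longrightarrow> x * y \<in> B"
    "x \<in> B \<Longrightarrow> c *\<^sub>C x \<in> B" "x \<in> B \<Longrightarrow> star x \<in> B" for x y c
    using assms by (auto simp: cstar_subalgebra_def)
  show "0 \<in> B"
    using *(5)[OF *(2), of 0] by simp
  show sc: "x \<in> B \<Longrightarrow> r *\<^sub>R x \<in> B" for x r
    by (simp add: scaleR_scaleC *)
  show neg: "x \<in> B \<Longrightarrow> - x \<in> B" for x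
    using sc[of x "-1"] by simp
  show "x \<in> B \<Longrightarrow> y \<in> B \<Longrightarrow> x - y \<in> B"
    using *(3)[OF _ neg, of x y] by simp
  show "x \<in> B \<Longrightarrow> x ^ k \<in> B"
    by (induction k) (auto simp: *)
qed

lemma cstar_subalgebra_sum:
  "cstar_subalgebra B \<Longrightarrow> (\<And>i. i \<in> I \<Longrightarrow> g i \<in> B) \<Longrightarrow> (\<Sum>i\<in>I. g i) \<in> B"
  by (induction I rule: infinite_finite_induct) (auto simp: cstar_subalgebraD)

lemma cstar_subalgebra_UNIV: "cstar_subalgebra UNIV"
  by (simp add: cstar_subalgebra_def)

text \<open>An element known to lie in every C*-subalgebra containing some \<open>c\<close>, such as
  the square roots below, inherits from \<open>c\<close> the property of commuting with
  \<open>y\<close>. Selfadjointness of \<open>y\<close> makes the commutant closed under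
  \<open>star\<close>.\<close>

lemma cstar_subalgebra_commutant:
  assumes "star y = y"
  shows "cstar_subalgebra {x. x * y = y * x}"
proof -
  have "closed {x. x * y = y * x}"
    by (intro closed_Collect_eq continuous_intros)
  moreover have "star x * y = y * star x" if "x * y = y * x" for x
    using arg_cong[OF that, of star] assms by (simp add: star_mult)
  ultimately show ?thesis
    by (simp add: cstar_subalgebra_def algebra_simps mult_scaleC_left mult_scaleC_right)
      (metis mult.assoc)
qed

text \<open>Products and adjoints are checked on the spanning set, then spread to the span by
  linearity and to the closure by continuity along sequences.\<close>

lemma cstar_subalgebra_closure_cspan:
  fixes X :: "'a::cstar_algebra set"
  assumes one: "1 \<in> cspan X"
    and mult: "\<And>x y. x \<in> X \<Longrightarrow> y \<in> X \<Longrightarrow> x * y \<in> cspan X"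
    and star: "\<And>x. x \<in> X \<Longrightarrow> star x \<in> cspan X"
  shows "cstar_subalgebra (closure (cspan X))"
proof -
  have smult: "x * y \<in> cspan X" if "x \<in> X" "y \<in> cspan X" for x y
    using that(2)
    by (induction rule: complex_vector.span_induct_alt)
      (auto simp: distrib_left mult_scaleC_right mult that(1)
        intro!: complex_vector.span_zero complex_vector.span_add complex_vector.span_scale)
  have mult': "x * y \<in> cspan X" if "x \<in> cspan X" "y \<in> cspan X" for x y
    using that(1)
    by (induction rule: complex_vector.span_induct_alt)
      (auto simp: distrib_right mult_scaleC_left smult that(2)
        intro!: complex_vector.span_zero complex_vector.span_add complex_vector.span_scale)
  have star': "star x \<in> cspan X" if "x \<in> cspan X" for x
    using that
    by (induction rule: complex_vector.span_induct_alt)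
      (auto simp: star_add star_scaleC star
        intro!: complex_vector.span_zero complex_vector.span_add complex_vector.span_scale)
  have lim2: "g x y \<in> closure (cspan X)"
    if "x \<in> closure (cspan X)" "y \<in> closure (cspan X)"
      and g: "\<And>x y. x \<in> cspan X \<Longrightarrow> y \<in> cspan X \<Longrightarrow> g x y \<in> cspan X"
      and cont: "\<And>s t a b. s \<longlonglongrightarrow> a \<Longrightarrow> t \<longlonglongrightarrow> b \<Longrightarrow> (\<lambda>n. g (s n) (t n)) \<longlonglongrightarrow> g a b" for g x y
  proof -
    obtain s t where "\<And>n. s n \<in> cspan X" "s \<longlonglongrightarrow> x" "\<And>n. t n \<in> cspan X" "t \<longlonglongrightarrow> y"
      using \<open>x \<in> _\<close> \<open>y \<in> _\<close> unfolding closure_sequential by blast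
    then show ?thesis
      unfolding closure_sequential using g cont by (intro exI[of _ "\<lambda>n. g (s n) (t n)"]) auto
  qed
  have lim1: "g x \<in> closure (cspan X)"
    if cl: "x \<in> closure (cspan X)" "\<And>x. x \<in> cspan X \<Longrightarrow> g x \<in> cspan X" "continuous_on UNIV g" for g x
  proof -
    have "isCont g x"
      using cl(3) by (simp add: continuous_on_eq_continuous_at)
    moreover obtain s where "\<And>n. s n \<in> cspan X" "s \<longlonglongrightarrow> x"
      using cl(1) unfolding closure_sequential by blast
    ultimately have "\<And>n. g (s n) \<in> cspan X" "(\<lambda>n. g (s n)) \<longlonglongrightarrow> g x"
      using cl(2) isCont_tendsto_compose by auto
    then show ?thesis
      unfolding closure_sequential by (intro exI[of _ "\<lambda>n. g (s n)"]) auto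
  qed
  show ?thesis
    unfolding cstar_subalgebra_def
  proof (intro conjI ballI allI)
    show "1 \<in> closure (cspan X)"
      using one closure_subset by blast
    fix x y assume xy: "x \<in> closure (cspan X)" "y \<in> closure (cspan X)"
    show "x + y \<in> closure (cspan X)"
      by (rule lim2[OF xy]) (auto intro: complex_vector.span_add tendsto_add)
    show "x * y \<in> closure (cspan X)"
      by (rule lim2[OF xy]) (auto intro: mult' tendsto_mult)
  next
    fix x c assume x: "x \<in> closure (cspan X)"
    show "c *\<^sub>C x \<in> closure (cspan X)"
      by (rule lim1[OF x _ continuous_scaleC]) (rule complex_vector.span_scale)
    show "star x \<in> closure (cspan X)"
      by (rule lim1[OF x star' continuous_star])
  qed simp
qed

lemma cstar_hull_eq_UNIV_subset:
  assumes "cstar_subalgebra hull X = UNIV" "cstar_subalgebra B" "X \<subseteq> B"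
  shows "B = UNIV"
  using hull_minimal[of X B cstar_subalgebra] assms by auto


subsection \<open>Square roots\<close>

text \<open>The Taylor coefficients of \<open>sqrt (1 - x)\<close> at 0.\<close>

definition sqrt_coeff :: "nat \<Rightarrow> real" where
  "sqrt_coeff k = (-1) ^ k * ((1/2) gchoose k)"

lemma sqrt_coeff_0 [simp]: "sqrt_coeff 0 = 1"
  by (simp add: sqrt_coeff_def)

text \<open>From index 1 on, consecutive coefficients have the positive ratio
  \<open>(k + 1/2) / (k + 2)\<close>, so all keep the sign of the coefficient -1/2 at index
  1.\<close>

lemma sqrt_coeff_Suc_nonpos: "sqrt_coeff (Suc k) \<le> 0"
proof (induction k)
  case (Suc k)
  have "sqrt_coeff (Suc (Suc k)) = sqrt_coeff (Suc k) * ((real k + 1/2) / (real k + 2))"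
    unfolding sqrt_coeff_def gbinomial_Suc_rec[of _ "Suc k"]
    by (simp add: field_simps gbinomial_absorption)
  then show ?case
    using mult_nonpos_nonneg[OF Suc, of "(real k + 1/2) / (real k + 2)"] by simp
qed (simp add: sqrt_coeff_def)

text \<open>An alternating partial row sum of generalized binomials collapses to a single one, which
  upper negation turns into a product of positive factors \<open>m - 1/2 - i\<close> over a
  factorial.\<close>

lemma sum_sqrt_coeff_nonneg: "0 \<le> (\<Sum>k\<le>m. sqrt_coeff k)"
proof -
  have "(\<Sum>k\<le>m. sqrt_coeff k) = (-1) ^ m * ((1/2 - 1) gchoose m)"
    unfolding sqrt_coeff_def using gbinomial_sum_lower_neg[of "1/2 :: real" m]
    by (simp add: mult.commute)
  also have "\<dots> = (of_nat m - 1/2) gchoose m"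
    using gbinomial_negated_upper[of "1/2 - 1 :: real" m] by (simp flip: power_mult_distrib mult.assoc)
  also have "\<dots> \<ge> 0"
    by (auto simp: gbinomial_prod_rev intro!: divide_nonneg_nonneg prod_nonneg)
  finally show ?thesis .
qed

text \<open>Only the coefficient at 0 is positive, so the absolute partial sums are 2 minus the
  plain ones, hence at most 2. This is what admits elements of norm exactly 1 in the series
  below.\<close>

lemma summable_abs_sqrt_coeff: "summable (\<lambda>k. \<bar>sqrt_coeff k\<bar>)"
proof (rule summableI_nonneg_bounded)
  fix m
  have "(\<Sum>k\<le>m. \<bar>sqrt_coeff k\<bar>) = 2 - (\<Sum>k\<le>m. sqrt_coeff k)"
    by (induction m) (use sqrt_coeff_Suc_nonpos in auto)
  then have "(\<Sum>k\<le>m. \<bar>sqrt_coeff k\<bar>) \<le> 2"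
    using sum_sqrt_coeff_nonneg[of m] by simp
  then show "(\<Sum>k<m. \<bar>sqrt_coeff k\<bar>) \<le> 2"
    using sum_mono2[of "{..m}" "{..<m}" "\<lambda>k. \<bar>sqrt_coeff k\<bar>"] by force
qed simp

text \<open>Vandermonde's identity for 1/2 + 1/2 = 1: the square of the series is
  \<open>1 - x\<close>.\<close>

lemma sqrt_coeff_convolution:
  "(\<Sum>i\<le>k. sqrt_coeff i * sqrt_coeff (k - i)) = (if k = 0 then 1 else if k = 1 then -1 else 0)"
proof -
  have "(\<Sum>i\<le>k. sqrt_coeff i * sqrt_coeff (k - i))
      = (-1) ^ k * (\<Sum>i\<in>{0..k}. ((1/2) gchoose i) * ((1/2) gchoose (k - i)))"
    unfolding sqrt_coeff_def sum_distrib_left atMost_atLeast0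
  proof (intro sum.cong refl)
    fix i assume "i \<in> {0..k}"
    then have "(-1) ^ k = (-1) ^ i * (-1 :: real) ^ (k - i)"
      by (simp flip: power_add)
    then show "(-1) ^ i * ((1/2) gchoose i) * ((-1) ^ (k - i) * ((1/2) gchoose (k - i)))
        = (-1) ^ k * (((1/2) gchoose i) * ((1/2 :: real) gchoose (k - i)))"
      by simp
  qed
  also have "\<dots> = (-1) ^ k * (real 1 gchoose k)"
    unfolding gbinomial_Vandermonde by simp
  also have "\<dots> = (-1) ^ k * real (1 choose k)"
    by (simp only: binomial_gbinomial)
  finally show ?thesis
    by (auto simp: binomial_eq_0)
qed

text \<open>The root is the binomial series evaluated at \<open>c\<close>. Its partial sums are real
  polynomials in \<open>c\<close>, which yields selfadjointness and membership in every
  C*-subalgebra containing \<open>c\<close>; that last clause later supplies commutation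
  relations.\<close>

lemma selfadjoint_sqrt:
  fixes c :: "'a::cstar_algebra"
  assumes sa: "star c = c" and c: "norm c \<le> 1"
  shows "\<exists>d. star d = d \<and> d * d = 1 - c \<and> (\<forall>B. cstar_subalgebra B \<longrightarrow> c \<in> B \<longrightarrow> d \<in> B)"
proof -
  define t where "t k = sqrt_coeff k *\<^sub>R c ^ k" for k
  have "norm (c ^ k) \<le> 1" for k
    using norm_power_ineq[of c k] power_le_one[OF norm_ge_zero c, of k] by linarith
  then have "norm (t k) \<le> \<bar>sqrt_coeff k\<bar>" for k
    by (simp add: t_def mult_left_le)
  then have sn: "summable (\<lambda>k. norm (t k))"
    by (intro summable_comparison_test[OF _ summable_abs_sqrt_coeff]) auto
  then have sm: "summable t"
    by (rule summable_norm_cancel)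
  have inB: "suminf t \<in> B" if "cstar_subalgebra B" "c \<in> B" for B
  proof -
    note B = cstar_subalgebraD[OF that(1)]
    have "(\<Sum>k<m. t k) \<in> B" for m
      by (induction m) (auto simp: t_def B that(2))
    then show ?thesis
      by (rule closed_sequentially[OF B(1) _ summable_LIMSEQ[OF sm]])
  qed
  have sums: "(\<lambda>k. \<Sum>i\<le>k. t i * t (k - i)) sums (suminf t * suminf t)"
    by (rule Cauchy_product_sums[OF sn sn])
  have "(\<Sum>i\<le>k. t i * t (k - i)) = (if k = 0 then 1 else if k = 1 then - c else 0)" for k
  proof -
    have "(\<Sum>i\<le>k. t i * t (k - i)) = (\<Sum>i\<le>k. (sqrt_coeff i * sqrt_coeff (k - i)) *\<^sub>R c ^ k)"
      by (intro sum.cong) (auto simp: t_def simp flip: power_add)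
    then show ?thesis
      by (simp flip: scaleR_sum_left add: sqrt_coeff_convolution)
  qed
  then have "(\<lambda>k. if k \<in> {0, 1} then (if k = 0 then 1 else - c) else 0) sums (suminf t * suminf t)"
    using sums by (elim back_subst[of "\<lambda>g. g sums _"]) auto
  moreover have "(\<lambda>k::nat. if k \<in> {0, 1} then (if k = 0 then 1 else - c) else 0) sums
      (\<Sum>k\<in>{0, 1::nat}. if k = 0 then 1 else - c)"
    by (rule sums_If_finite_set) simp
  ultimately have "suminf t * suminf t = 1 - c"
    by (auto dest: sums_unique2)
  moreover have "star (suminf t) = suminf t"
  proof -
    have "(\<lambda>m. star (\<Sum>k<m. t k)) \<longlonglongrightarrow> star (suminf t)"
      using summable_LIMSEQ[OF sm] continuous_star[of UNIV]
      by (auto simp: continuous_on_eq_continuous_at intro: isCont_tendsto_compose)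
    moreover have "star (\<Sum>k<m. t k) = (\<Sum>k<m. t k)" for m
      by (simp add: star_sum t_def star_scaleR star_power sa)
    ultimately show ?thesis
      using summable_LIMSEQ[OF sm] LIMSEQ_unique by auto
  qed
  ultimately show ?thesis
    using inB by blast
qed

text \<open>
  An element \<open>a\<close> with \<open>\<parallel>1 - a\<parallel> \<le> 1\<close> is a square. A summand of a vanishing sum of such elements
  satisfies this condition up to scaling together with its negative, and two commuting
  selfadjoint elements whose squares cancel are zero.
\<close>

lemma sum_positive_eq_0:
  fixes a :: "'i \<Rightarrow> 'a::cstar_algebra"
  assumes "finite J" and sa: "\<And>j. j \<in> J \<Longrightarrow> star (a j) = a j"
    and pos: "\<And>j. j \<in> J \<Longrightarrow> norm (1 - a j) \<le> 1"
    and "(\<Sum>j\<in>J. a j) = 0" and "j \<in> J"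
  shows "a j = 0"
proof -
  define m where "m = real (card J)"
  have m: "m > 0"
    using assms by (auto simp: m_def card_gt_0_iff)
  define b where "b = a j"
  \<comment> \<open>The choice makes \<open>1 - c\<close> equal to \<open>- b\<close> divided by
    \<open>m\<close>. Since \<open>- b\<close> is the sum of the other summands, \<open>c\<close> is
    the average of 1 and the elements \<open>1 - a i\<close> with \<open>i \<noteq> j\<close>, all
    of norm at most 1.\<close>
  define c where "c = 1 + (1 / m) *\<^sub>R b"
  have b_sum: "b = - (\<Sum>i\<in>J - {j}. a i)"
    using assms by (simp add: b_def sum.remove eq_neg_iff_add_eq_0)
  have "m *\<^sub>R c = 1 + (\<Sum>i\<in>J - {j}. 1 - a i)"
  proof -
    have "1 + (\<Sum>i\<in>J - {j}. 1 - a i) = 1 + of_nat (card J - 1) + b"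
      using assms(1,5) by (simp add: b_sum sum_subtractf)
    also have "1 + of_nat (card J - 1) = (of_nat (card J) :: 'a)"
      using m by (metis m_def of_nat_0_less_iff of_nat_Suc Suc_diff_1)
    also have "\<dots> + b = m *\<^sub>R c"
      using m by (simp add: c_def scaleR_add_right) (simp add: m_def scaleR_conv_of_real)
    finally show ?thesis ..
  qed
  also have "norm \<dots> \<le> 1 + (\<Sum>i\<in>J - {j}. 1)"
    by (intro norm_triangle_le add_mono sum_norm_le) (auto intro: pos)
  also have "\<dots> = m"
    using assms(1,5) m unfolding m_def by simp
  finally have nc: "norm c \<le> 1"
    using m by simp
  have sb: "star b = b"
    using assms by (simp add: b_def)
  have sc: "star c = c"
    by (simp add: c_def star_add star_scaleR sb)
  obtain d where d: "star d = d" "d * d = b" "\<And>B. cstar_subalgebra B \<Longrightarrow> 1 - b \<in> B \<Longrightarrow> d \<in> B"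
    using selfadjoint_sqrt[of "1 - b"] pos[OF assms(5)] sb by (auto simp: b_def star_diff)
  obtain e where e: "star e = e" "e * e = 1 - c" "\<And>B. cstar_subalgebra B \<Longrightarrow> c \<in> B \<Longrightarrow> e \<in> B"
    using selfadjoint_sqrt[OF sc nc] by blast
  \<comment> \<open>Commutation in two stages: \<open>e\<close> lies in the commutant of
    \<open>b\<close> because \<open>c\<close> does, and then \<open>d\<close> lies in the commutant
    of \<open>e\<close> because \<open>1 - b\<close> does.\<close>
  have "e * b = b * e"
    using e(3)[OF cstar_subalgebra_commutant[OF sb]] by (simp add: c_def algebra_simps)
  then have "d * e = e * d"
    using d(3)[OF cstar_subalgebra_commutant[OF e(1)]] by (simp add: algebra_simps)
  \<comment> \<open>The factor \<open>sqrt m\<close> undoes the scaling in \<open>c\<close>: the two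
    squares are \<open>b\<close> and \<open>- b\<close>.\<close>
  moreover have "d * d + (sqrt m *\<^sub>R e) * (sqrt m *\<^sub>R e) = 0"
    using m by (simp add: d(2) e(2) c_def)
  ultimately have "(norm d)\<^sup>2 \<le> 0"
    using norm_power2_le_commuting[of d "sqrt m *\<^sub>R e"] by (simp add: d(1) e(1) star_scaleR)
  then show ?thesis
    using d(2) by (simp add: b_def)
qed

text \<open>For selfadjoint \<open>a\<close> in the unit ball of \<open>B\<close>, a root
  \<open>d\<close> of \<open>1 - a * a\<close> lies in \<open>B\<close> and commutes with
  \<open>a\<close>, so the squares of \<open>f a\<close> and \<open>f d\<close> add up to 1 and
  force \<open>norm (f a) \<le> 1\<close>. Scaling and the C*-identity then reach every element of
  \<open>B\<close>.\<close>

lemma star_hom_norm_le: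
  fixes f :: "'a::cstar_algebra \<Rightarrow> 'a"
  assumes B: "cstar_subalgebra B" and f: "unital_star_hom_on B f" and "x \<in> B"
  shows "norm (f x) \<le> norm x"
proof -
  note B' = cstar_subalgebraD[OF B]
  have f': "f 1 = 1" "\<And>x y. x \<in> B \<Longrightarrow> y \<in> B \<Longrightarrow> f (x + y) = f x + f y"
    "\<And>x y. x \<in> B \<Longrightarrow> y \<in> B \<Longrightarrow> f (x * y) = f x * f y"
    "\<And>c x. x \<in> B \<Longrightarrow> f (c *\<^sub>C x) = c *\<^sub>C f x" "\<And>x. x \<in> B \<Longrightarrow> f (star x) = star (f x)"
    using f by (auto simp: unital_star_hom_on_def)
  have *: "norm (f a) \<le> 1" if a: "a \<in> B" "star a = a" "norm a \<le> 1" for a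
  proof -
    have "norm (a * a) \<le> 1"
      using cstar_identity[of a] a by (simp add: power_le_one)
    then obtain d where d: "star d = d" "d * d = 1 - a * a"
        "\<And>B. cstar_subalgebra B \<Longrightarrow> a * a \<in> B \<Longrightarrow> d \<in> B"
      using selfadjoint_sqrt[of "a * a"] a by (auto simp: star_mult)
    have dB: "d \<in> B"
      using d(3)[OF B] a B' by blast
    have "d * a = a * d"
      using d(3)[OF cstar_subalgebra_commutant[OF a(2)]] by (simp add: mult.assoc)
    then have "f a * f d = f d * f a"
      using f'(3)[OF a(1) dB] f'(3)[OF dB a(1)] by simp
    moreover have "f a * f a + f d * f d = f (a * a + d * d)"
      by (simp add: f' a dB B')
    then have "f a * f a + f d * f d = 1"
      by (simp add: d(2) f')
    moreover have "star (f a) = f a" "star (f d) = f d"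
      using f'(5) a dB d(1) by metis+
    ultimately have "(norm (f a))\<^sup>2 \<le> 1"
      using norm_power2_le_commuting[of "f a" "f d"] by simp
    then show ?thesis
      by (simp add: power_le_one_iff abs_square_le_1)
  qed
  have sa: "norm (f a) \<le> norm a" if a: "a \<in> B" "star a = a" for a
  proof (cases "a = 0")
    case True
    then show ?thesis
      using f'(4)[of 1 0] B'(2) by simp
  next
    case False
    have "norm (f ((1 / norm a) *\<^sub>R a)) \<le> 1"
      using False a by (intro *) (auto simp: star_scaleR B')
    then show ?thesis
      using False by (simp add: scaleR_scaleC f'(4) a norm_scaleC field_simps norm_divide)
  qed
  have "(norm (f x))\<^sup>2 = norm (f (star x * x))"
    using \<open>x \<in> B\<close> by (simp add: f' B' cstar_identity)
  also have "\<dots> \<le> norm (star x * x)"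
    using \<open>x \<in> B\<close> by (intro sa) (auto simp: star_mult star_star B')
  finally show ?thesis
    by (simp add: cstar_identity power2_le_iff_abs_le)
qed

lemma star_hom_continuous_on:
  fixes f :: "'a::cstar_algebra \<Rightarrow> 'a"
  assumes B: "cstar_subalgebra B" and f: "unital_star_hom_on B f"
  shows "continuous_on B f"
proof -
  note B' = cstar_subalgebraD[OF B]
  have "dist (f x) (f y) \<le> dist x y" if "x \<in> B" "y \<in> B" for x y
  proof -
    have "f (x - y) = f (x + (-1) *\<^sub>C y)"
      by simp
    also have "\<dots> = f x + (-1) *\<^sub>C f y"
      using f that B'(5)[of y "-1"] unfolding unital_star_hom_on_def by metis
    also have "\<dots> = f x - f y"
      by simp
    finally show ?thesis
      using star_hom_norm_le[OF assms, of "x - y"] that by (simp add: dist_norm B')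
  qed
  then show ?thesis
    unfolding continuous_on_iff by (meson le_less_trans)
qed


section \<open>Words in the Cuntz algebra\<close>

lemma word_Nil [simp]: "word S [] = 1"
  by (simp add: word_def)

lemma word_Cons [simp]: "word S (i # \<mu>) = S i * word S \<mu>"
  by (simp add: word_def)

lemma word_append: "word S (\<mu> @ \<nu>) = word S \<mu> * word S \<nu>"
  by (simp add: word_def)

text \<open>With the diagonal viewed as the continuous functions on infinite words, this is the
  indicator of the words beginning with \<open>\<mu>\<close>.\<close>

definition cylinder :: "(nat \<Rightarrow> 'a::cstar_algebra) \<Rightarrow> nat list \<Rightarrow> 'a" where
  "cylinder S \<mu> = word S \<mu> * star (word S \<mu>)"

lemma cylinder_Nil [simp]: "cylinder S [] = 1"
  by (simp add: cylinder_def)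

lemma cylinder_singleton: "cylinder S [i] = S i * star (S i)"
  by (simp add: cylinder_def)

lemma star_cylinder [simp]: "star (cylinder S \<mu>) = cylinder S \<mu>"
  by (simp add: cylinder_def star_mult star_star)

lemma cylinder_append: "cylinder S (\<mu> @ \<nu>) = word S \<mu> * cylinder S \<nu> * star (word S \<mu>)"
  by (simp add: cylinder_def word_append star_mult mult.assoc)

lemma cylinder_Cons: "cylinder S (i # \<mu>) = S i * cylinder S \<mu> * star (S i)"
  using cylinder_append[of S "[i]" \<mu>] by simp

locale cuntz =
  fixes n :: nat and S :: "nat \<Rightarrow> 'a::cstar_algebra"
  assumes cuntz: "cuntz_algebra n S"
begin

declare One_nat_def [simp del]

lemma isometry: "i \<in> {1..n} \<Longrightarrow> star (S i) * S i = 1"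
  using cuntz by (auto simp: cuntz_algebra_def)

lemma sum_range_projections: "(\<Sum>i=1..n. S i * star (S i)) = 1"
  using cuntz by (auto simp: cuntz_algebra_def)

text \<open>The positive elements \<open>a k\<close> sum to 1 while \<open>a j\<close> is already 1,
  so the others sum to 0 and vanish individually. Finally \<open>a i\<close> is
  \<open>star x * x\<close> for \<open>x = star (S i) * S j\<close>.\<close>

lemma orthogonal_isometries:
  assumes i: "i \<in> {1..n}" and j: "j \<in> {1..n}" and "i \<noteq> j"
  shows "star (S i) * S j = 0"
proof -
  define a where "a k = star (S j) * (S k * star (S k)) * S j" for k
  have "(\<Sum>k=1..n. a k) = star (S j) * (\<Sum>k=1..n. S k * star (S k)) * S j"
    by (simp add: a_def sum_distrib_left sum_distrib_right)
  also have "\<dots> = 1"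
    by (simp add: sum_range_projections isometry[OF j])
  finally have "(\<Sum>k=1..n. a k) = a j"
    by (simp add: a_def mult.assoc isometry[OF j])
  then have "(\<Sum>k\<in>{1..n} - {j}. a k) = 0"
    using sum.remove[of "{1..n}" j a] j by simp
  moreover have "star (a k) = a k" for k
    by (simp add: a_def star_mult star_star mult.assoc)
  moreover have "norm (1 - a k) \<le> 1" if k: "k \<in> {1..n}" for k
  proof -
    \<comment> \<open>\<open>1 - a k\<close> is the compression by \<open>S j\<close> of the
      complementary projection \<open>p\<close>, hence has norm at most 1.\<close>
    define p where "p = 1 - S k * star (S k)"
    have "S k * star (S k) * (S k * star (S k)) = S k * (star (S k) * S k) * star (S k)"
      by (simp add: mult.assoc)
    then have "norm p \<le> 1"
      by (intro norm_projection_le_one)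
        (simp_all add: p_def star_diff star_mult star_star algebra_simps isometry[OF k])
    have "1 - a k = star (S j) * p * S j"
      by (simp add: a_def p_def algebra_simps isometry[OF j])
    then have "norm (1 - a k) \<le> norm (star (S j)) * norm p * norm (S j)"
      using norm_mult_ineq[of "star (S j) * p" "S j"] norm_mult_ineq[of "star (S j)" p]
        mult_right_mono[of "norm (star (S j) * p)" "norm (star (S j)) * norm p" "norm (S j)"]
      by simp
    then show ?thesis
      using \<open>norm p \<le> 1\<close> norm_isometry[OF isometry[OF j]] by simp
  qed
  ultimately have "a i = 0"
    using assms by (intro sum_positive_eq_0[of "{1..n} - {j}" a i]) auto
  then have "star (star (S i) * S j) * (star (S i) * S j) = 0"
    by (simp add: a_def star_mult star_star mult.assoc)
  then show ?thesis
    by (simp only: star_mult_self_eq_0)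
qed

lemma star_S_mult_S:
  "i \<in> {1..n} \<Longrightarrow> j \<in> {1..n} \<Longrightarrow> star (S i) * S j = (if i = j then 1 else 0)"
  by (simp add: isometry orthogonal_isometries)

lemma star_S_mult_S_mult:
  "i \<in> {1..n} \<Longrightarrow> j \<in> {1..n} \<Longrightarrow> star (S i) * (S j * x) = (if i = j then x else 0)"
  using star_S_mult_S[of i j] by (simp flip: mult.assoc)

lemma isometry_word: "set \<mu> \<subseteq> {1..n} \<Longrightarrow> star (word S \<mu>) * word S \<mu> = 1"
  by (induction \<mu>) (auto simp: star_mult mult.assoc star_S_mult_S_mult)

lemma orthogonal_words:
  "length \<mu> = length \<nu> \<Longrightarrow> set \<mu> \<subseteq> {1..n} \<Longrightarrow> set \<nu> \<subseteq> {1..n} \<Longrightarrow>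
    star (word S \<mu>) * word S \<nu> = (if \<mu> = \<nu> then 1 else 0)"
  by (induction \<mu> \<nu> rule: list_induct2) (auto simp: star_mult mult.assoc star_S_mult_S_mult)

lemma cylinder_idem: "set \<mu> \<subseteq> {1..n} \<Longrightarrow> cylinder S \<mu> * cylinder S \<mu> = cylinder S \<mu>"
  unfolding cylinder_def
  by (metis isometry_word mult.assoc mult.right_neutral)

lemma cylinder_nonzero:
  assumes "set \<mu> \<subseteq> {1..n}"
  shows "cylinder S \<mu> \<noteq> 0"
proof
  assume "cylinder S \<mu> = 0"
  then have "star (word S \<mu>) * (word S \<mu> * star (word S \<mu>)) * word S \<mu> = 0"
    by (simp add: cylinder_def)
  then show False
    using isometry_word[OF assms] by (simp add: mult.assoc)
qed


subsection \<open>The shift\<close>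

lemma shift_add: "shift n S (x + y) = shift n S x + shift n S y"
  by (simp add: shift_def algebra_simps sum.distrib)

lemma shift_scaleC: "shift n S (c *\<^sub>C x) = c *\<^sub>C shift n S x"
  by (simp add: shift_def mult_scaleC_left mult_scaleC_right complex_vector.scale_sum_right)

lemma shift_one: "shift n S 1 = 1"
  by (simp add: shift_def sum_range_projections)

lemma shift_zero: "shift n S 0 = 0"
  by (simp add: shift_def)

lemma shift_mult_S: "i \<in> {1..n} \<Longrightarrow> shift n S x * S i = S i * x"
  by (simp add: shift_def sum_distrib_right mult.assoc star_S_mult_S if_distrib sum.delta
      cong: if_cong)

lemma star_S_mult_shift: "i \<in> {1..n} \<Longrightarrow> star (S i) * shift n S x = x * star (S i)"
  by (simp add: shift_def sum_distrib_left mult.assoc star_S_mult_S_mult if_distrib sum.delta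
      cong: if_cong)

lemma star_shift: "star (shift n S x) = shift n S (star x)"
  by (simp add: shift_def star_sum star_mult star_star mult.assoc)

lemma shift_mult: "shift n S (x * y) = shift n S x * shift n S y"
proof -
  have "shift n S x * shift n S y = (\<Sum>i=1..n. (shift n S x * S i) * y * star (S i))"
    by (simp add: shift_def[of n S y] sum_distrib_left mult.assoc)
  also have "\<dots> = (\<Sum>i=1..n. S i * (x * y) * star (S i))"
    by (intro sum.cong) (auto simp: shift_mult_S mult.assoc)
  finally show ?thesis
    by (simp add: shift_def)
qed

lemma shift_sum: "shift n S (\<Sum>i\<in>I. g i) = (\<Sum>i\<in>I. shift n S (g i))"
  by (induction I rule: infinite_finite_induct) (auto simp: shift_add shift_zero)

lemma funpow_shift_simps:
  shows funpow_shift_zero: "(shift n S ^^ k) 0 = 0"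
    and funpow_shift_one: "(shift n S ^^ k) 1 = 1"
    and funpow_shift_mult: "(shift n S ^^ k) (x * y) = (shift n S ^^ k) x * (shift n S ^^ k) y"
    and funpow_shift_scaleC: "(shift n S ^^ k) (c *\<^sub>C x) = c *\<^sub>C (shift n S ^^ k) x"
    and star_funpow_shift: "star ((shift n S ^^ k) x) = (shift n S ^^ k) (star x)"
    and funpow_shift_sum: "(shift n S ^^ k) (\<Sum>i\<in>I. g i) = (\<Sum>i\<in>I. (shift n S ^^ k) (g i))"
  by (induction k)
    (auto simp: shift_zero shift_one shift_add shift_mult shift_scaleC star_shift shift_sum)

text \<open>Compression by \<open>S 1\<close> is a left inverse of the shift.\<close>

lemma shift_inj:
  assumes "n \<ge> 1" "shift n S x = shift n S y"
  shows "x = y"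
proof -
  have *: "star (S 1) * shift n S z * S 1 = z" for z
    using assms(1) by (simp add: star_S_mult_shift isometry mult.assoc)
  have "x = star (S 1) * shift n S x * S 1"
    by (rule *[symmetric])
  also have "\<dots> = y"
    unfolding assms(2) by (rule *)
  finally show ?thesis .
qed

lemma funpow_shift_eq_0: "n \<ge> 1 \<Longrightarrow> (shift n S ^^ k) x = 0 \<longleftrightarrow> x = 0"
proof (induction k)
  case (Suc k)
  have "shift n S ((shift n S ^^ k) x) = 0 \<longleftrightarrow> (shift n S ^^ k) x = 0"
    using shift_inj[OF Suc.prems, of "(shift n S ^^ k) x" 0] shift_zero by auto
  with Suc show ?case
    by simp
qed simp

lemma word_mult_shift:
  "set \<mu> \<subseteq> {1..n} \<Longrightarrow> word S \<mu> * x = (shift n S ^^ length \<mu>) x * word S \<mu>"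
proof (induction \<mu>)
  case (Cons i \<mu>)
  have "word S (i # \<mu>) * x = S i * ((shift n S ^^ length \<mu>) x * word S \<mu>)"
    using Cons by (simp add: mult.assoc)
  also have "\<dots> = (shift n S ^^ length (i # \<mu>)) x * word S (i # \<mu>)"
    using Cons.prems shift_mult_S[of i] by (simp flip: mult.assoc)
  finally show ?case .
qed simp

lemma star_word_mult_shift:
  assumes "set \<mu> \<subseteq> {1..n}"
  shows "star (word S \<mu>) * (shift n S ^^ length \<mu>) x = x * star (word S \<mu>)"
  using arg_cong[OF word_mult_shift[OF assms, of "star x"], of star]
  by (simp add: star_mult star_star star_funpow_shift)

text \<open>Removing a prefix of length \<open>length \<nu>\<close> and adding one of length
  \<open>length \<mu>\<close> translates whatever starts at depth \<open>l\<close> by the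
  difference. The bound on \<open>\<nu>\<close> keeps the removed prefix clear of \<open>x\<close>
  and the subtraction untruncated.\<close>

lemma word_pair_mult_shift:
  assumes "set \<mu> \<subseteq> {1..n}" "set \<nu> \<subseteq> {1..n}" "length \<nu> \<le> l"
  shows "word S \<mu> * star (word S \<nu>) * (shift n S ^^ l) x
    = (shift n S ^^ (l + length \<mu> - length \<nu>)) x * (word S \<mu> * star (word S \<nu>))"
proof -
  have "(shift n S ^^ l) x = (shift n S ^^ length \<nu>) ((shift n S ^^ (l - length \<nu>)) x)"
    using assms(3) funpow_add[of "length \<nu>" "l - length \<nu>" "shift n S"] by simp
  then have "word S \<mu> * star (word S \<nu>) * (shift n S ^^ l) x
      = word S \<mu> * (shift n S ^^ (l - length \<nu>)) x * star (word S \<nu>)"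
    by (simp add: star_word_mult_shift[OF assms(2)] mult.assoc)
  also have "\<dots> = (shift n S ^^ length \<mu>) ((shift n S ^^ (l - length \<nu>)) x) * word S \<mu> * star (word S \<nu>)"
    by (simp add: word_mult_shift[OF assms(1)])
  also have "(shift n S ^^ length \<mu>) ((shift n S ^^ (l - length \<nu>)) x)
      = (shift n S ^^ (l + length \<mu> - length \<nu>)) x"
    using assms(3) funpow_add[of "length \<mu>" "l - length \<nu>" "shift n S"] by (simp add: add.commute)
  finally show ?thesis
    by (simp add: mult.assoc)
qed

section \<open>Cylinder projections and their letters\<close>

lemma cylinder_Cons_shift:
  "i \<in> {1..n} \<Longrightarrow> cylinder S (i # \<mu>) = cylinder S [i] * shift n S (cylinder S \<mu>)"
  by (simp add: cylinder_Cons mult.assoc star_S_mult_shift)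

lemma shift_cylinder: "shift n S (cylinder S \<mu>) = (\<Sum>i=1..n. cylinder S (i # \<mu>))"
  by (simp add: shift_def cylinder_Cons)

lemma cylinder_split: "cylinder S \<mu> = (\<Sum>i=1..n. cylinder S (\<mu> @ [i]))"
proof -
  have "(\<Sum>i=1..n. cylinder S (\<mu> @ [i]))
      = word S \<mu> * (\<Sum>i=1..n. S i * star (S i)) * star (word S \<mu>)"
    by (simp add: cylinder_append cylinder_singleton sum_distrib_left sum_distrib_right)
  then show ?thesis
    by (simp add: sum_range_projections cylinder_def)
qed

text \<open>A cylinder projection lies below each of its letter projections: front letters are
  stripped with \<open>shift_mult_S\<close> until the letter in question comes first and idempotence
  applies.\<close>

lemma shift_letter_mult_cylinder:
  assumes "set \<mu> \<subseteq> {1..n}" "l < length \<mu>"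
  shows "(shift n S ^^ l) (cylinder S [\<mu> ! l]) * cylinder S \<mu> = cylinder S \<mu>"
  using assms
proof (induction \<mu> arbitrary: l)
  case (Cons i \<mu>)
  show ?case
  proof (cases l)
    case 0
    have "cylinder S [i] * cylinder S (i # \<mu>) = cylinder S [i] * cylinder S [i] * shift n S (cylinder S \<mu>)"
      using Cons.prems by (simp add: cylinder_Cons_shift[of i \<mu>] mult.assoc)
    then show ?thesis
      using Cons.prems 0 cylinder_idem[of "[i]"] cylinder_Cons_shift[of i \<mu>] by simp
  next
    case (Suc l')
    have "(shift n S ^^ l) (cylinder S [(i # \<mu>) ! l]) * cylinder S (i # \<mu>)
        = shift n S ((shift n S ^^ l') (cylinder S [\<mu> ! l'])) * S i * (cylinder S \<mu> * star (S i))"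
      by (simp add: Suc cylinder_Cons mult.assoc)
    also have "\<dots> = S i * ((shift n S ^^ l') (cylinder S [\<mu> ! l']) * cylinder S \<mu>) * star (S i)"
      using Cons.prems by (simp add: shift_mult_S mult.assoc)
    also have "\<dots> = cylinder S (i # \<mu>)"
      using Cons Suc by (simp add: cylinder_Cons)
    finally show ?thesis .
  qed
qed simp

lemma shift_letter_orthogonal:
  assumes "i \<in> {1..n}" "j \<in> {1..n}" "i \<noteq> j"
  shows "(shift n S ^^ l) (cylinder S [i]) * (shift n S ^^ l) (cylinder S [j]) = 0"
proof -
  have "cylinder S [i] * cylinder S [j] = 0"
    using assms by (simp add: cylinder_singleton mult.assoc star_S_mult_S_mult)
  then show ?thesis
    by (metis funpow_shift_mult funpow_shift_zero)
qed

subsection \<open>Dense subalgebras\<close>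

text \<open>Letters cancel in pairs from the front. Either two of them clash and orthogonality kills
  the product, or one word is a prefix of the other and the rest of the longer one survives.\<close>

lemma star_word_mult_word:
  assumes "set \<mu> \<subseteq> {1..n}" "set \<nu> \<subseteq> {1..n}"
  shows "star (word S \<mu>) * word S \<nu> = 0 \<or>
    (\<exists>\<kappa>. \<nu> = \<mu> @ \<kappa> \<and> star (word S \<mu>) * word S \<nu> = word S \<kappa>) \<or>
    (\<exists>\<kappa>. \<mu> = \<nu> @ \<kappa> \<and> star (word S \<mu>) * word S \<nu> = star (word S \<kappa>))"
  using assms
proof (induction \<mu> arbitrary: \<nu>)
  case (Cons i \<mu>)
  show ?case
  proof (cases \<nu>)
    case (Cons j \<nu>')
    have "star (word S (i # \<mu>)) * word S \<nu> = (if i = j then star (word S \<mu>) * word S \<nu>' else 0)"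
      using Cons.prems Cons by (simp add: star_mult mult.assoc star_S_mult_S_mult)
    then show ?thesis
      using Cons.IH[of \<nu>'] Cons.prems Cons by auto
  qed simp
qed simp

definition words where "words = {\<mu>. set \<mu> \<subseteq> {1..n}}"

lemma cstar_subalgebra_closure_word_pairs:
  "cstar_subalgebra (closure (cspan {word S \<mu> * star (word S \<nu>) |\<mu> \<nu>. \<mu> \<in> words \<and> \<nu> \<in> words}))"
  (is "cstar_subalgebra (closure (cspan ?X))")
proof (rule cstar_subalgebra_closure_cspan)
  have inX: "word S \<mu> * star (word S \<nu>) \<in> cspan ?X" if "\<mu> \<in> words" "\<nu> \<in> words" for \<mu> \<nu>
    using that by (intro complex_vector.span_base) blast
  show "1 \<in> cspan ?X"
    using inX[of "[]" "[]"] by (simp add: words_def)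
  show "star x \<in> cspan ?X" if x: "x \<in> ?X" for x
    using x by (auto simp: star_mult star_star inX)
  show "x * y \<in> cspan ?X" if xy: "x \<in> ?X" "y \<in> ?X" for x y
  proof -
    obtain \<mu> \<nu> \<mu>' \<nu>' where w: "\<mu> \<in> words" "\<nu> \<in> words" "\<mu>' \<in> words" "\<nu>' \<in> words"
      and x: "x = word S \<mu> * star (word S \<nu>)" and y: "y = word S \<mu>' * star (word S \<nu>')"
      using xy by blast
    have xy': "x * y = word S \<mu> * (star (word S \<nu>) * word S \<mu>') * star (word S \<nu>')"
      by (simp add: x y mult.assoc)
    consider "star (word S \<nu>) * word S \<mu>' = 0"
      | \<kappa> where "\<mu>' = \<nu> @ \<kappa>" "star (word S \<nu>) * word S \<mu>' = word S \<kappa>"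
      | \<kappa> where "\<nu> = \<mu>' @ \<kappa>" "star (word S \<nu>) * word S \<mu>' = star (word S \<kappa>)"
      using star_word_mult_word[of \<nu> \<mu>'] w unfolding words_def by blast
    then show ?thesis
    proof cases
      case 1
      then show ?thesis
        by (simp add: xy' complex_vector.span_zero)
    next
      case (2 \<kappa>)
      then have "x * y = word S (\<mu> @ \<kappa>) * star (word S \<nu>')"
        by (simp add: xy' word_append del: mult.assoc)
      then show ?thesis
        using inX[of "\<mu> @ \<kappa>" \<nu>'] w 2 by (simp add: words_def)
    next
      case (3 \<kappa>)
      then have "x * y = word S \<mu> * star (word S (\<nu>' @ \<kappa>))"
        using xy' by (simp add: word_append[of S \<nu>' \<kappa>] star_mult mult.assoc)
      then show ?thesis
        using inX[of \<mu> "\<nu>' @ \<kappa>"] w 3 by (simp add: words_def)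
    qed
  qed
qed

lemma cstar_generated:
  assumes "cstar_subalgebra B" "\<And>i. i \<in> {1..n} \<Longrightarrow> S i \<in> B"
  shows "x \<in> B"
proof -
  have "cstar_subalgebra hull (S ` {1..n}) = UNIV"
    using cuntz by (simp add: cuntz_algebra_def)
  then show ?thesis
    using cstar_hull_eq_UNIV_subset[OF _ assms(1)] assms(2) by blast
qed

lemma closure_word_pairs:
  "closure (cspan {word S \<mu> * star (word S \<nu>) |\<mu> \<nu>. \<mu> \<in> words \<and> \<nu> \<in> words}) = UNIV"
proof (intro equalityI subset_UNIV subsetI)
  fix x
  have "S i \<in> closure (cspan {word S \<mu> * star (word S \<nu>) |\<mu> \<nu>. \<mu> \<in> words \<and> \<nu> \<in> words})"
    if "i \<in> {1..n}" for i
  proof -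
    have "word S [i] * star (word S []) \<in> {word S \<mu> * star (word S \<nu>) |\<mu> \<nu>. \<mu> \<in> words \<and> \<nu> \<in> words}"
      using that by (intro CollectI exI[of _ "[i]"] exI[of _ "[]"]) (auto simp: words_def)
    then have "word S [i] * star (word S []) \<in>
        closure (cspan {word S \<mu> * star (word S \<nu>) |\<mu> \<nu>. \<mu> \<in> words \<and> \<nu> \<in> words})"
      by (rule subsetD[OF closure_subset complex_vector.span_base])
    then show ?thesis
      by simp
  qed
  then show "x \<in> closure (cspan {word S \<mu> * star (word S \<nu>) |\<mu> \<nu>. \<mu> \<in> words \<and> \<nu> \<in> words})"
    by (rule cstar_generated[OF cstar_subalgebra_closure_word_pairs])
qed

section \<open>The diagonal as the closed span of the cylinder projections\<close>

lemma diagonal_level_eq: "diagonal_level n S k = cspan (cylinder S ` multi_indices n k)"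
  unfolding diagonal_level_def cylinder_def by (rule arg_cong[of _ _ cspan]) auto

lemma diagonal_level_Suc: "diagonal_level n S k \<subseteq> diagonal_level n S (Suc k)"
  unfolding diagonal_level_eq
proof (rule complex_vector.span_minimal)
  show "cylinder S ` multi_indices n k \<subseteq> cspan (cylinder S ` multi_indices n (Suc k))"
  proof safe
    fix \<mu> assume "\<mu> \<in> multi_indices n k"
    then have "cylinder S (\<mu> @ [i]) \<in> cspan (cylinder S ` multi_indices n (Suc k))" if "i \<in> {1..n}" for i
      using that by (intro complex_vector.span_base) (auto simp: multi_indices_def)
    then show "cylinder S \<mu> \<in> cspan (cylinder S ` multi_indices n (Suc k))"
      unfolding cylinder_split[of \<mu>] by (intro complex_vector.span_sum) auto
  qed
qed (rule complex_vector.subspace_span)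

lemma diagonal_level_mono: "k \<le> l \<Longrightarrow> diagonal_level n S k \<subseteq> diagonal_level n S l"
  using lift_Suc_mono_le[of "diagonal_level n S"] diagonal_level_Suc by blast

lemma Union_diagonal_level: "(\<Union>k\<in>{1..}. diagonal_level n S k) = cspan (cylinder S ` words)"
proof
  show "(\<Union>k\<in>{1..}. diagonal_level n S k) \<subseteq> cspan (cylinder S ` words)"
    unfolding diagonal_level_eq
    by (intro UN_least complex_vector.span_mono image_mono) (auto simp: words_def multi_indices_def)
  show "cspan (cylinder S ` words) \<subseteq> (\<Union>k\<in>{1..}. diagonal_level n S k)"
  proof
    fix x assume "x \<in> cspan (cylinder S ` words)"
    then show "x \<in> (\<Union>k\<in>{1..}. diagonal_level n S k)"
    proof (induction rule: complex_vector.span_induct_alt)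
      case base
      then show ?case
        by (auto simp: diagonal_level_eq complex_vector.span_zero)
    next
      case (step c x y)
      then obtain \<mu> k where \<mu>: "x = cylinder S \<mu>" "\<mu> \<in> words" "y \<in> diagonal_level n S k"
        by blast
      \<comment> \<open>A level above those of both \<open>x\<close> and \<open>y\<close>; the
        successor guarantees \<open>l \<ge> 1\<close>, where the union starts.\<close>
      define l where "l = Suc (length \<mu> + k)"
      have "x \<in> diagonal_level n S (length \<mu>)"
        using \<mu> unfolding diagonal_level_eq
        by (auto simp: words_def multi_indices_def intro!: complex_vector.span_base)
      then have "x \<in> diagonal_level n S l" "y \<in> diagonal_level n S l"
        using \<mu> diagonal_level_mono[of "length \<mu>" l] diagonal_level_mono[of k l] by (auto simp: l_def)
      then have "c *\<^sub>C x + y \<in> diagonal_level n S l"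
        unfolding diagonal_level_eq
        by (intro complex_vector.span_add complex_vector.span_scale)
      then show ?case
        by (auto simp: l_def)
    qed
  qed
qed

lemma diagonal_eq: "diagonal n S = closure (cspan (cylinder S ` words))"
  unfolding diagonal_def Union_diagonal_level ..

lemma cspan_cylinder_subset_diagonal: "cspan (cylinder S ` words) \<subseteq> diagonal n S"
  unfolding diagonal_eq by (rule closure_subset)

lemma cylinder_mult_cylinder:
  assumes "\<mu> \<in> words" "\<nu> \<in> words"
  shows "cylinder S \<mu> * cylinder S \<nu> \<in> {0, cylinder S \<mu>, cylinder S \<nu>}"
proof -
  have "cylinder S \<mu> * cylinder S \<nu> = word S \<mu> * (star (word S \<mu>) * word S \<nu>) * star (word S \<nu>)"
    by (simp add: cylinder_def mult.assoc)
  moreover consider "star (word S \<mu>) * word S \<nu> = 0"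
    | \<kappa> where "\<nu> = \<mu> @ \<kappa>" "star (word S \<mu>) * word S \<nu> = word S \<kappa>"
    | \<kappa> where "\<mu> = \<nu> @ \<kappa>" "star (word S \<mu>) * word S \<nu> = star (word S \<kappa>)"
    using star_word_mult_word[of \<mu> \<nu>] assms unfolding words_def by blast
  then have "word S \<mu> * (star (word S \<mu>) * word S \<nu>) * star (word S \<nu>) \<in> {0, cylinder S \<mu>, cylinder S \<nu>}"
  proof cases
    case (2 \<kappa>)
    then show ?thesis
      unfolding 2(2) by (simp add: cylinder_def[of S "\<mu> @ \<kappa>"] word_append)
  next
    case (3 \<kappa>)
    then show ?thesis
      unfolding 3(2) by (simp add: cylinder_def[of S "\<nu> @ \<kappa>"] word_append star_mult mult.assoc)
  qed simp
  ultimately show ?thesis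
    by simp
qed

lemma cstar_subalgebra_diagonal: "cstar_subalgebra (diagonal n S)"
  unfolding diagonal_eq
proof (rule cstar_subalgebra_closure_cspan)
  have *: "cylinder S \<mu> \<in> cspan (cylinder S ` words)" if "\<mu> \<in> words" for \<mu>
    using that by (intro complex_vector.span_base) blast
  show "1 \<in> cspan (cylinder S ` words)"
    using *[of "[]"] by (simp add: words_def)
  show "x * y \<in> cspan (cylinder S ` words)"
    if xy: "x \<in> cylinder S ` words" "y \<in> cylinder S ` words" for x y
  proof -
    obtain \<mu> \<nu> where "x = cylinder S \<mu>" "y = cylinder S \<nu>" "\<mu> \<in> words" "\<nu> \<in> words"
      using xy by blast
    then show ?thesis
      using cylinder_mult_cylinder[of \<mu> \<nu>] *[of \<mu>] *[of \<nu>] complex_vector.span_zero by auto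
  qed
  show "star x \<in> cspan (cylinder S ` words)" if "x \<in> cylinder S ` words" for x
    using that * by auto
qed

text \<open>An automorphism of the diagonal obeys the homomorphism laws on the diagonal only, so
  this is the side condition for applying them to shifted cylinders. Each shift turns a cylinder
  into a sum of cylinders with one more letter.\<close>

lemma funpow_shift_cylinder_in_diagonal:
  assumes "\<mu> \<in> words"
  shows "(shift n S ^^ k) (cylinder S \<mu>) \<in> diagonal n S"
proof -
  have step: "shift n S x \<in> cspan (cylinder S ` words)" if "x \<in> cspan (cylinder S ` words)" for x
    using that
  proof (induction rule: complex_vector.span_induct_alt)
    case base
    then show ?case
      by (simp add: shift_zero complex_vector.span_zero)
  next
    case (step c x y)
    then obtain \<mu> where "x = cylinder S \<mu>" "\<mu> \<in> words"
      by blast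
    then have "shift n S x \<in> cspan (cylinder S ` words)"
      unfolding shift_cylinder \<open>x = _\<close>
      by (intro complex_vector.span_sum complex_vector.span_base imageI) (auto simp: words_def)
    then show ?case
      using step by (auto simp: shift_add shift_scaleC
          intro!: complex_vector.span_add complex_vector.span_scale)
  qed
  have "(shift n S ^^ k) (cylinder S \<mu>) \<in> cspan (cylinder S ` words)"
    by (induction k) (simp_all add: step complex_vector.span_base assms)
  then show ?thesis
    using cspan_cylinder_subset_diagonal by blast
qed

section \<open>Endomorphisms determined by their values on the generators\<close>

lemma endomorphism_eqI:
  assumes f: "endomorphism f" and g: "endomorphism g" and "\<And>i. i \<in> {1..n} \<Longrightarrow> f (S i) = g (S i)"
  shows "f = g"
proof
  fix x
  \<comment> \<open>The equalizer is closed because *-homomorphisms are automatically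
    continuous.\<close>
  have "cstar_subalgebra {x. f x = g x}"
    unfolding cstar_subalgebra_def
    using f g closed_Collect_eq[OF star_hom_continuous_on star_hom_continuous_on, OF
        cstar_subalgebra_UNIV f cstar_subalgebra_UNIV g]
    by (auto simp: unital_star_hom_on_def)
  then show "f x = g x"
    using cstar_generated[of "{x. f x = g x}" x] assms(3) by blast
qed

text \<open>The universal property is applied with the algebra itself as target, presented as the
  structure \<open>type_cstar\<close>, where \<open>finsum\<close> is the ordinary sum.\<close>

lemma endomorphism_exists:
  assumes iso: "\<And>i. i \<in> {1..n} \<Longrightarrow> star (T i) * T i = 1" and sum: "(\<Sum>i=1..n. T i * star (T i)) = 1"
  shows "\<exists>f. endomorphism f \<and> (\<forall>i\<in>{1..n}. f (S i) = T i)"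
proof -
  interpret R: Ring.ring "type_cstar :: 'a cstar_struct"
    by (rule ring_type_cstar)
  have "finsum type_cstar h I = sum h I" if "finite I" for h :: "nat \<Rightarrow> 'a" and I
    using that by (induction I rule: finite_induct) (auto simp: Pi_def)
  then have "cuntz_family type_cstar n T"
    using iso sum by (simp add: cuntz_family_def)
  then obtain f where "unital_star_hom_into type_cstar f" "\<forall>i\<in>{1..n}. f (S i) = T i"
    using cuntz unital_cstar_algebra_type_cstar unfolding cuntz_algebra_def by blast
  then show ?thesis
    by (auto simp: unital_star_hom_into_def unital_star_hom_on_def)
qed

end


section \<open>Product type automorphisms\<close>

lemma cspan_image_finite:
  assumes "finite I" "x \<in> cspan (g ` I)"
  shows "\<exists>c. x = (\<Sum>i\<in>I. c i *\<^sub>C g i)"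
  using assms(2)
proof (induction rule: complex_vector.span_induct_alt)
  case base
  then show ?case
    by (intro exI[of _ "\<lambda>_. 0"]) simp
next
  case (step c x y)
  then obtain j d where j: "j \<in> I" "x = g j" and y: "y = (\<Sum>i\<in>I. d i *\<^sub>C g i)"
    by blast
  have "(\<Sum>i\<in>I. ((if i = j then c else 0) + d i) *\<^sub>C g i)
      = (\<Sum>i\<in>I. if i = j then c *\<^sub>C g i else 0) + y"
    unfolding y sum.distrib[symmetric] by (intro sum.cong) (auto simp: scaleC_add_left)
  also have "\<dots> = c *\<^sub>C x + y"
    using j assms(1) by simp
  finally show ?case
    by metis
qed

locale product_type = cuntz n S for n :: nat and S :: "nat \<Rightarrow> 'a::cstar_algebra" +
  fixes \<alpha> :: "'a \<Rightarrow> 'a"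
  assumes n_ge_2: "n \<ge> 2" and product_type: "product_type_automorphism n S \<alpha>"
begin

section \<open>Letter projections and the permutations that \<alpha> induces on them\<close>

lemma hom: "unital_star_hom_on (diagonal n S) \<alpha>"
  using product_type by (simp add: product_type_automorphism_def star_automorphism_on_def)

lemma hom_simps:
  shows hom_one: "\<alpha> 1 = 1"
    and hom_add: "x \<in> diagonal n S \<Longrightarrow> y \<in> diagonal n S \<Longrightarrow> \<alpha> (x + y) = \<alpha> x + \<alpha> y"
    and hom_mult: "x \<in> diagonal n S \<Longrightarrow> y \<in> diagonal n S \<Longrightarrow> \<alpha> (x * y) = \<alpha> x * \<alpha> y"
    and hom_scaleC: "x \<in> diagonal n S \<Longrightarrow> \<alpha> (c *\<^sub>C x) = c *\<^sub>C \<alpha> x"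
  using hom by (auto simp: unital_star_hom_on_def)

lemma hom_zero: "\<alpha> 0 = 0"
  using hom_scaleC[of 1 0] cstar_subalgebraD(2)[OF cstar_subalgebra_diagonal] by simp

lemma hom_sum: "(\<And>i. i \<in> I \<Longrightarrow> g i \<in> diagonal n S) \<Longrightarrow> \<alpha> (\<Sum>i\<in>I. g i) = (\<Sum>i\<in>I. \<alpha> (g i))"
proof (induction I rule: infinite_finite_induct)
  case (insert i I)
  have "(\<Sum>i\<in>I. g i) \<in> diagonal n S"
    using insert.prems by (intro cstar_subalgebra_sum[OF cstar_subalgebra_diagonal]) auto
  then show ?case
    using insert by (simp add: hom_add)
qed (auto simp: hom_zero)

text \<open>On infinite words, the indicator of those with letter \<open>i\<close> at position
  \<open>k\<close>, counted from 0.\<close>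

definition letter :: "nat \<Rightarrow> nat \<Rightarrow> 'a" where
  "letter k i = (shift n S ^^ k) (cylinder S [i])"

lemma letter_mult:
  assumes "i \<in> {1..n}" "j \<in> {1..n}"
  shows "letter k i * letter k j = (if i = j then letter k i else 0)"
  using assms shift_letter_orthogonal[of i j k] cylinder_idem[of "[i]"]
  by (auto simp: letter_def simp flip: funpow_shift_mult)

lemma letter_nonzero: "i \<in> {1..n} \<Longrightarrow> letter k i \<noteq> 0"
  using n_ge_2 by (simp add: letter_def funpow_shift_eq_0 cylinder_nonzero)

lemma letter_inj: "i \<in> {1..n} \<Longrightarrow> j \<in> {1..n} \<Longrightarrow> letter k i = letter k j \<Longrightarrow> i = j"
  using letter_mult[of i i k] letter_mult[of i j k] letter_nonzero[of i k] by metis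

lemma letter_in_diagonal: "i \<in> {1..n} \<Longrightarrow> letter k i \<in> diagonal n S"
  unfolding letter_def by (rule funpow_shift_cylinder_in_diagonal) (simp add: words_def)

lemma level_permutation_iff:
  "level_permutation n S \<alpha> k \<sigma> \<longleftrightarrow>
    \<sigma> permutes {1..n} \<and> (\<forall>i\<in>{1..n}. \<alpha> (letter k i) = letter k (\<sigma> i))"
  by (simp add: level_permutation_def letter_def cylinder_singleton)

lemma hom_letter_expansion:
  assumes "i \<in> {1..n}"
  shows "\<exists>c. \<alpha> (letter k i) = (\<Sum>j=1..n. c j *\<^sub>C letter k j)"
proof -
  have mi: "multi_indices n 1 = (\<lambda>j. [j]) ` {1..n}"
    by (auto simp: multi_indices_def length_Suc_conv One_nat_def)
  have lev: "diagonal_level n S 1 = cspan ((\<lambda>j. cylinder S [j]) ` {1..n})"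
    unfolding diagonal_level_eq mi image_image ..
  have "cylinder S [i] \<in> diagonal_level n S 1"
    using assms unfolding lev by (intro complex_vector.span_base) blast
  then have "\<alpha> (letter k i) \<in> \<alpha> ` (shift n S ^^ k) ` diagonal_level n S 1"
    unfolding letter_def by blast
  then have "\<alpha> (letter k i) \<in> (shift n S ^^ k) ` diagonal_level n S 1"
    using product_type by (simp add: product_type_automorphism_def)
  then obtain z where z: "\<alpha> (letter k i) = (shift n S ^^ k) z" "z \<in> diagonal_level n S 1"
    by blast
  then obtain c where "z = (\<Sum>j=1..n. c j *\<^sub>C cylinder S [j])"
    using cspan_image_finite[of "{1..n}" z "\<lambda>j. cylinder S [j]"] lev by auto
  then show ?thesis
    using z(1) by (auto simp: funpow_shift_sum funpow_shift_scaleC letter_def)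
qed

text \<open>Let \<open>c\<close> be the matrix of \<alpha> in the letter projections of level
  \<open>k\<close>. Idempotence makes its entries 0 or 1, orthogonality allows at most one 1 per
  column, and injectivity demands at least one per row; a finite square matrix of this kind is a
  permutation matrix.\<close>

lemma level_permutation_exists: "\<exists>\<sigma>. level_permutation n S \<alpha> k \<sigma>"
proof -
  define I where "I = {1..n}"
  have "\<forall>i\<in>I. \<exists>c. \<alpha> (letter k i) = (\<Sum>j\<in>I. c j *\<^sub>C letter k j)"
    using hom_letter_expansion unfolding I_def by blast
  then obtain c where c: "\<And>i. i \<in> I \<Longrightarrow> \<alpha> (letter k i) = (\<Sum>j\<in>I. c i j *\<^sub>C letter k j)"
    by metis
  have fin: "finite I"
    by (simp add: I_def)
  have mult: "letter k i * letter k j = (if i = j then letter k i else 0)" if "i \<in> I" "j \<in> I" for i j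
    using that letter_mult by (simp add: I_def)
  have nz: "letter k i \<noteq> 0" and D: "letter k i \<in> diagonal n S" if "i \<in> I" for i
    using that letter_nonzero letter_in_diagonal by (auto simp: I_def)
  \<comment> \<open>Multiplication by \<open>letter k j\<close> isolates the coefficient at
    \<open>j\<close>.\<close>
  have coeff: "\<alpha> (letter k i) * letter k j = c i j *\<^sub>C letter k j" if "i \<in> I" "j \<in> I" for i j
  proof -
    have "\<alpha> (letter k i) * letter k j = (\<Sum>l\<in>I. if l = j then c i l *\<^sub>C letter k l else 0)"
      unfolding c[OF that(1)] sum_distrib_right
      by (intro sum.cong refl) (use that in \<open>auto simp: mult_scaleC_left mult\<close>)
    then show ?thesis
      using that fin by simp
  qed
  have coeff2: "\<alpha> (letter k i * letter k i') * letter k j = (c i' j * c i j) *\<^sub>C letter k j"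
    if "i \<in> I" "i' \<in> I" "j \<in> I" for i i' j
    using that by (simp add: hom_mult D mult.assoc coeff mult_scaleC_right scaleC_scaleC)
  have idem: "c i j = 0 \<or> c i j = 1" if "i \<in> I" "j \<in> I" for i j
  proof -
    have "(c i j * c i j) *\<^sub>C letter k j = c i j *\<^sub>C letter k j"
      using coeff2[of i i j] coeff[of i j] that by (simp add: mult)
    then show ?thesis
      using nz[OF that(2)] by simp
  qed
  have orth: "c i j = 0 \<or> c i' j = 0" if "i \<in> I" "i' \<in> I" "j \<in> I" "i \<noteq> i'" for i i' j
    using coeff2[of i i' j] that nz[of j] by (auto simp: mult hom_zero)
  have "\<exists>j\<in>I. c i j = 1" if "i \<in> I" for i
  proof (rule ccontr)
    assume "\<not> (\<exists>j\<in>I. c i j = 1)"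
    then have "\<alpha> (letter k i) = 0"
      unfolding c[OF that] using idem that by (intro sum.neutral) force
    then have "\<alpha> (letter k i) = \<alpha> 0"
      by (simp add: hom_zero)
    moreover have "inj_on \<alpha> (diagonal n S)"
      using product_type
      by (simp add: product_type_automorphism_def star_automorphism_on_def bij_betw_def)
    ultimately show False
      using D[OF that] nz[OF that] cstar_subalgebraD(7)[OF cstar_subalgebra_diagonal]
      by (auto dest: inj_onD)
  qed
  then obtain s where s: "\<And>i. i \<in> I \<Longrightarrow> s i \<in> I" "\<And>i. i \<in> I \<Longrightarrow> c i (s i) = 1"
    by metis
  have inj: "inj_on s I"
    using orth s by (intro inj_onI) (metis zero_neq_one)
  then have surj: "s ` I = I"
    using s(1) fin by (intro endo_inj_surj) auto
  have "\<alpha> (letter k i) = letter k (s i)" if i: "i \<in> I" for i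
  proof -
    \<comment> \<open>As \<open>s\<close> is onto, column \<open>j\<close> already has its 1 in some
      row \<open>i'\<close>, so its entry in any other row is 0.\<close>
    have "c i j = (if j = s i then 1 else 0)" if j: "j \<in> I" for j
    proof -
      obtain i' where "i' \<in> I" "j = s i'"
        using surj j by blast
      then show ?thesis
        using orth[of i i' j] i j s by (cases "i = i'") (auto simp: inj_on_eq_iff[OF inj])
    qed
    then have "\<alpha> (letter k i) = (\<Sum>j\<in>I. if j = s i then letter k j else 0)"
      unfolding c[OF i] by (intro sum.cong) auto
    then show ?thesis
      using fin s(1)[OF i] by simp
  qed
  \<comment> \<open>\<open>permutes\<close> demands the identity outside \<open>I\<close>, where
    \<open>s\<close> is unspecified.\<close>
  moreover have "(\<lambda>i. if i \<in> I then s i else i) permutes I"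
  proof (rule bij_imp_permutes)
    show "bij_betw (\<lambda>i. if i \<in> I then s i else i) I I"
      using inj surj by (auto simp: bij_betw_def inj_on_def)
  qed simp
  ultimately have "level_permutation n S \<alpha> k (\<lambda>i. if i \<in> I then s i else i)"
    by (simp add: level_permutation_iff flip: I_def)
  then show ?thesis
    by (intro exI)
qed

lemma level_permutation_unique:
  assumes "level_permutation n S \<alpha> k \<sigma>" "level_permutation n S \<alpha> k \<tau>"
  shows "\<sigma> = \<tau>"
proof
  fix i
  show "\<sigma> i = \<tau> i"
  proof (cases "i \<in> {1..n}")
    case True
    then have "\<sigma> i \<in> {1..n}" "\<tau> i \<in> {1..n}" "letter k (\<sigma> i) = letter k (\<tau> i)"
      using assms unfolding level_permutation_iff by (metis permutes_in_image)+
    then show ?thesis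
      by (rule letter_inj)
  next
    case False
    then show ?thesis
      using assms permutes_not_in unfolding level_permutation_iff by metis
  qed
qed

lemma level_permutation_ex1: "\<exists>!\<sigma>. level_permutation n S \<alpha> k \<sigma>"
  using level_permutation_exists level_permutation_unique by blast

text \<open>Peeling off the first letter leaves the rest of the word one level deeper; inductions
  along words in both directions of the theorem rest on this.\<close>

lemma funpow_shift_cylinder_Cons:
  "i \<in> {1..n} \<Longrightarrow>
    (shift n S ^^ k) (cylinder S (i # \<mu>)) = letter k i * (shift n S ^^ Suc k) (cylinder S \<mu>)"
  by (simp only: cylinder_Cons_shift[of i \<mu>] letter_def funpow_shift_mult funpow_Suc_right comp_apply)


end


section \<open>Extendible automorphisms are eventually identical\<close>

lemma inj_on_avoids_value:
  assumes "inj_on g {1..n}" "n \<ge> (2::nat)"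
  shows "\<exists>c\<in>{1..n}. g c \<noteq> v"
proof -
  have "g 1 \<noteq> g 2"
    using assms by (auto simp: inj_on_eq_iff)
  then show ?thesis
    using assms(2) by (metis atLeastAtMost_iff le_trans one_le_numeral order_refl)
qed

text \<open>The words with letters \<open>a l (\<eta> l)\<close> and \<open>b l (\<eta> l)\<close>
  must clash between \<open>k\<close> and \<open>N\<close> after every translation by at most
  \<open>M\<close>, in either direction. Offset 0 is settled by the given difference at
  \<open>k\<close>, and each further offset by letters at fresh positions, where having two letters
  to choose from suffices.\<close>

lemma incompatible_word_exists:
  fixes a b :: "nat \<Rightarrow> nat \<Rightarrow> nat"
  assumes n: "n \<ge> 2" and inj: "\<And>l. inj_on (a l) {1..n}" "\<And>l. inj_on (b l) {1..n}"
    and i: "i \<in> {1..n}" "a k i \<noteq> b k i"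
  shows "\<exists>N \<eta>. (\<forall>l. \<eta> l \<in> {1..n}) \<and> (\<forall>m\<le>M.
    (\<exists>l\<ge>k. l + m < N \<and> a l (\<eta> l) \<noteq> b (l + m) (\<eta> (l + m))) \<and>
    (\<exists>l\<ge>k. l + m < N \<and> a (l + m) (\<eta> (l + m)) \<noteq> b l (\<eta> l)))"
proof (induction M)
  case 0
  then show ?case
    using i by (intro exI[of _ "Suc k"] exI[of _ "\<lambda>_. i"]) auto
next
  case (Suc M)
  then obtain N \<eta> where \<eta>: "\<And>l. \<eta> l \<in> {1..n}"
    "\<And>m. m \<le> M \<Longrightarrow> \<exists>l\<ge>k. l + m < N \<and> a l (\<eta> l) \<noteq> b (l + m) (\<eta> (l + m))"
    "\<And>m. m \<le> M \<Longrightarrow> \<exists>l\<ge>k. l + m < N \<and> a (l + m) (\<eta> (l + m)) \<noteq> b l (\<eta> l)"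
    by blast
  have "k \<le> N"
    using \<eta>(2)[of 0] by auto
  \<comment> \<open>Two fresh pairs at distance \<open>Suc M\<close>: \<open>N\<close> and
    \<open>N + Suc M\<close> serve one direction, \<open>u\<close> and \<open>u + Suc M\<close> the
    other. As \<open>u\<close> is the first position after the former pair, the four are distinct.
    Positions below \<open>N\<close> keep their letters and all remaining ones get the default
    letter 1.\<close>
  define u where "u = N + Suc M + 1"
  obtain c where c: "c \<in> {1..n}" "b (N + Suc M) c \<noteq> a N 1"
    using inj_on_avoids_value[OF inj(2) n] by blast
  obtain d where d: "d \<in> {1..n}" "a (u + Suc M) d \<noteq> b u 1"
    using inj_on_avoids_value[OF inj(1) n] by blast
  define \<eta>' where "\<eta>' l = (if l < N then \<eta> l else if l = N + Suc M then c
      else if l = u + Suc M then d else 1)" for l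
  have old: "\<eta>' l = \<eta> l" if "l < N" for l
    using that by (simp add: \<eta>'_def)
  have new: "\<eta>' N = 1" "\<eta>' (N + Suc M) = c" "\<eta>' u = 1" "\<eta>' (u + Suc M) = d"
    by (auto simp: \<eta>'_def u_def)
  have "(\<exists>l\<ge>k. l + m < u + Suc M + 1 \<and> a l (\<eta>' l) \<noteq> b (l + m) (\<eta>' (l + m))) \<and>
    (\<exists>l\<ge>k. l + m < u + Suc M + 1 \<and> a (l + m) (\<eta>' (l + m)) \<noteq> b l (\<eta>' l))" if m: "m \<le> Suc M" for m
  proof (cases "m = Suc M")
    case True
    have "a N (\<eta>' N) \<noteq> b (N + m) (\<eta>' (N + m))" "a (u + m) (\<eta>' (u + m)) \<noteq> b u (\<eta>' u)"
      using c d unfolding True new by auto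
    moreover have "N + m < u + Suc M + 1" "u + m < u + Suc M + 1" "k \<le> u"
      using True \<open>k \<le> N\<close> by (auto simp: u_def)
    ultimately show ?thesis
      using \<open>k \<le> N\<close> by blast
  next
    case False
    then have "m \<le> M"
      using m by simp
    then obtain l l' where "l \<ge> k" "l + m < N" "a l (\<eta> l) \<noteq> b (l + m) (\<eta> (l + m))"
      "l' \<ge> k" "l' + m < N" "a (l' + m) (\<eta> (l' + m)) \<noteq> b l' (\<eta> l')"
      using \<eta>(2,3) by blast
    then have "l \<ge> k" "l + m < u + Suc M + 1" "a l (\<eta>' l) \<noteq> b (l + m) (\<eta>' (l + m))"
      "l' \<ge> k" "l' + m < u + Suc M + 1" "a (l' + m) (\<eta>' (l' + m)) \<noteq> b l' (\<eta>' l')"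
      by (auto simp: old u_def)
    then show ?thesis
      by blast
  qed
  moreover have "\<eta>' l \<in> {1..n}" for l
    using \<eta>(1)[of l] c d n by (simp add: \<eta>'_def)
  ultimately show ?case
    by blast
qed

section \<open>The translation argument against extendibility\<close>

context product_type
begin

text \<open>\<open>M\<close> bounds the word lengths in a finite expansion of \<open>z\<close>.
  Phrasing this by annihilation hides the expansion: to kill \<open>z\<close> between
  \<open>y\<close> and \<open>x\<close> it suffices to kill the short monomials.\<close>

lemma word_pair_span_annihilated:
  assumes "z \<in> cspan {word S \<mu> * star (word S \<nu>) |\<mu> \<nu>. \<mu> \<in> words \<and> \<nu> \<in> words}"
  shows "\<exists>M. \<forall>x y. (\<forall>\<mu>\<in>words. \<forall>\<nu>\<in>words. length \<mu> \<le> M \<longrightarrow> length \<nu> \<le> M \<longrightarrow>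
    y * (word S \<mu> * star (word S \<nu>)) * x = 0) \<longrightarrow> y * z * x = 0"
  using assms
proof (induction rule: complex_vector.span_induct_alt)
  case (step c t z)
  then obtain M where M: "\<And>x y. (\<forall>\<mu>\<in>words. \<forall>\<nu>\<in>words. length \<mu> \<le> M \<longrightarrow> length \<nu> \<le> M \<longrightarrow>
    y * (word S \<mu> * star (word S \<nu>)) * x = 0) \<Longrightarrow> y * z * x = 0"
    by blast
  obtain \<mu> \<nu> where t: "t = word S \<mu> * star (word S \<nu>)" "\<mu> \<in> words" "\<nu> \<in> words"
    using step by blast
  show ?case
  proof (intro exI[of _ "M + length \<mu> + length \<nu>"] allI impI)
    fix x y
    assume *: "\<forall>\<mu>'\<in>words. \<forall>\<nu>'\<in>words. length \<mu>' \<le> M + length \<mu> + length \<nu> \<longrightarrow>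
      length \<nu>' \<le> M + length \<mu> + length \<nu> \<longrightarrow> y * (word S \<mu>' * star (word S \<nu>')) * x = 0"
    have "y * z * x = 0"
      using * by (intro M) auto
    moreover have "y * t * x = 0"
      using * t by simp
    ultimately show "y * (c *\<^sub>C t + z) * x = 0"
      by (simp add: distrib_left distrib_right mult_scaleC_left mult_scaleC_right)
  qed
qed simp

lemma extendible_imp_eventually_constant:
  assumes f: "endomorphism f" and ext: "extends n S \<alpha> f"
    and \<sigma>: "\<And>k. level_permutation n S \<alpha> k (\<sigma> k)"
  shows "\<exists>K. \<forall>k\<ge>K. \<sigma> (Suc k) = \<sigma> k"
proof (rule ccontr)
  assume "\<not> ?thesis"
  then have often: "\<exists>k\<ge>M. \<sigma> (Suc k) \<noteq> \<sigma> k" for M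
    by blast
  have perm: "\<sigma> k permutes {1..n}" and \<sigma>_letter: "i \<in> {1..n} \<Longrightarrow> \<alpha> (letter k i) = letter k (\<sigma> k i)"
    for k i
    using \<sigma> by (auto simp: level_permutation_iff)
  have \<sigma>_in: "i \<in> {1..n} \<Longrightarrow> \<sigma> k i \<in> {1..n}" for k i
    using permutes_in_image[OF perm] by blast
  have f': "f 1 = 1" "\<And>x y. f (x + y) = f x + f y" "\<And>x y. f (x * y) = f x * f y"
    "\<And>x. f (star x) = star (f x)" "\<And>c x. f (c *\<^sub>C x) = c *\<^sub>C f x"
    using f by (auto simp: unital_star_hom_on_def)
  have f0: "f 0 = 0"
    using f'(5)[of 0 0] by simp
  \<comment> \<open>The element with \<open>f (S i) = v * S i\<close>. It is an isometry, so left
    multiplication by it preserves norms.\<close>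
  define v where "v = (\<Sum>i=1..n. f (S i) * star (S i))"
  have vS: "v * S i = f (S i)" if "i \<in> {1..n}" for i
    using that by (simp add: v_def sum_distrib_right mult.assoc star_S_mult_S if_distrib cong: if_cong)
  have iso: "star v * v = 1"
  proof -
    have "star v * v = (\<Sum>i=1..n. S i * star (f (S i)) * v)"
      by (simp add: v_def star_sum star_mult star_star sum_distrib_right)
    also have "\<dots> = (\<Sum>i=1..n. S i * star (S i))"
    proof (intro sum.cong refl)
      fix i assume i: "i \<in> {1..n}"
      have "star (f (S i)) * v = (\<Sum>j=1..n. f (star (S i) * S j) * star (S j))"
        by (simp add: v_def sum_distrib_left f' mult.assoc)
      also have "\<dots> = (\<Sum>j=1..n. if j = i then star (S j) else 0)"
        using i by (intro sum.cong refl) (simp add: star_S_mult_S f' f0)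
      also have "\<dots> = star (S i)"
        using i by simp
      finally show "S i * star (f (S i)) * v = S i * star (S i)"
        by (simp add: mult.assoc)
    qed
    finally show ?thesis
      by (simp add: sum_range_projections)
  qed
  \<comment> \<open>\<open>v\<close> intertwines the two orders of composing \<open>f\<close> with
    the shift. Starting from a letter of level \<open>k\<close>, one order permutes it by
    \<open>\<sigma> k\<close> and the other by \<open>\<sigma> (Suc k)\<close>, both results being
    at level \<open>Suc k\<close>; this is \<open>v_letter\<close>.\<close>
  have inter: "v * shift n S (f x) = f (shift n S x) * v" for x
  proof -
    have "v * shift n S (f x) = (\<Sum>i=1..n. v * S i * f x * star (S i))"
      by (simp add: shift_def sum_distrib_left mult.assoc)
    also have "\<dots> = (\<Sum>i=1..n. f (S i * x) * star (S i))"
      by (intro sum.cong) (auto simp: vS f')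
    also have "\<dots> = (\<Sum>i=1..n. f (shift n S x * S i) * star (S i))"
      by (intro sum.cong) (auto simp: shift_mult_S)
    also have "\<dots> = f (shift n S x) * v"
      by (simp add: v_def sum_distrib_left f' mult.assoc)
    finally show ?thesis .
  qed
  have v_letter: "v * letter (Suc k) (\<sigma> k i) = letter (Suc k) (\<sigma> (Suc k) i) * v" if i: "i \<in> {1..n}" for i k
  proof -
    have Suc_letter: "letter (Suc k) j = shift n S (letter k j)" for j
      by (simp add: letter_def)
    have "f (letter l i) = letter l (\<sigma> l i)" for l
      using ext letter_in_diagonal[OF i] \<sigma>_letter[OF i] by (simp add: extends_def)
    then show ?thesis
      using inter[of "letter k i"] by (simp flip: Suc_letter)
  qed
  \<comment> \<open>The same comparison for a block of letters at levels \<open>Suc k\<close> to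
    \<open>k + L\<close>, one letter at a time.\<close>
  have v_cyl: "v * (shift n S ^^ Suc k) (cylinder S (map (\<lambda>l. \<sigma> l (\<eta> l)) [k..<k + L]))
      = (shift n S ^^ Suc k) (cylinder S (map (\<lambda>l. \<sigma> (Suc l) (\<eta> l)) [k..<k + L])) * v"
    if \<eta>: "\<And>l. \<eta> l \<in> {1..n}" for \<eta> k L
  proof (induction L arbitrary: k)
    case 0
    then show ?case
      by (simp add: funpow_shift_one del: funpow.simps)
  next
    case (Suc L)
    have upt: "[k..<k + Suc L] = k # [Suc k..<Suc k + L]"
      by (simp add: upt_conv_Cons)
    have "v * (shift n S ^^ Suc k) (cylinder S (map (\<lambda>l. \<sigma> l (\<eta> l)) [k..<k + Suc L]))
        = v * letter (Suc k) (\<sigma> k (\<eta> k))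
          * (shift n S ^^ Suc (Suc k)) (cylinder S (map (\<lambda>l. \<sigma> l (\<eta> l)) [Suc k..<Suc k + L]))"
      unfolding upt list.map funpow_shift_cylinder_Cons[OF \<sigma>_in[OF \<eta>]] by (simp only: mult.assoc)
    also have "\<dots> = letter (Suc k) (\<sigma> (Suc k) (\<eta> k))
          * (v * (shift n S ^^ Suc (Suc k)) (cylinder S (map (\<lambda>l. \<sigma> l (\<eta> l)) [Suc k..<Suc k + L])))"
      unfolding v_letter[OF \<eta>] by (simp only: mult.assoc)
    also have "\<dots> = (shift n S ^^ Suc k) (cylinder S (map (\<lambda>l. \<sigma> (Suc l) (\<eta> l)) [k..<k + Suc L])) * v"
      unfolding Suc.IH upt list.map funpow_shift_cylinder_Cons[OF \<sigma>_in[OF \<eta>]] by (simp only: mult.assoc)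
    finally show ?case .
  qed
  have "v \<in> closure (cspan {word S \<mu> * star (word S \<nu>) |\<mu> \<nu>. \<mu> \<in> words \<and> \<nu> \<in> words})"
    unfolding closure_word_pairs ..
  \<comment> \<open>Any tolerance below 1 would do: in the end \<open>norm x\<close> is bounded by
    the tolerance times \<open>norm x\<close>.\<close>
  then obtain z where z: "z \<in> cspan {word S \<mu> * star (word S \<nu>) |\<mu> \<nu>. \<mu> \<in> words \<and> \<nu> \<in> words}"
    and vz: "dist z v < 1/2"
    unfolding closure_approachable by (meson half_gt_zero zero_less_one)
  obtain M where M: "\<And>x y. (\<forall>\<mu>\<in>words. \<forall>\<nu>\<in>words. length \<mu> \<le> M \<longrightarrow> length \<nu> \<le> M \<longrightarrow>
      y * (word S \<mu> * star (word S \<nu>)) * x = 0) \<Longrightarrow> y * z * x = 0"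
    using word_pair_span_annihilated[OF z] by blast
  \<comment> \<open>\<open>k \<ge> M\<close> puts the letters at levels above \<open>k\<close>
    beyond the reach of every \<open>\<nu>\<close> of length at most \<open>M\<close>, so short
    monomials act on them as pure translations.\<close>
  obtain k i where k: "k \<ge> M" and neq: "\<sigma> k i \<noteq> \<sigma> (Suc k) i"
    using often[of M] unfolding fun_eq_iff by metis
  have i: "i \<in> {1..n}"
    using neq permutes_not_in[OF perm] by metis
  obtain N \<eta> where \<eta>: "\<And>l. \<eta> l \<in> {1..n}"
    and right: "\<And>m. m \<le> M \<Longrightarrow> \<exists>l\<ge>k. l + m < N \<and> \<sigma> l (\<eta> l) \<noteq> \<sigma> (Suc (l + m)) (\<eta> (l + m))"
    and left: "\<And>m. m \<le> M \<Longrightarrow> \<exists>l\<ge>k. l + m < N \<and> \<sigma> (l + m) (\<eta> (l + m)) \<noteq> \<sigma> (Suc l) (\<eta> l)"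
    using incompatible_word_exists[OF n_ge_2, of \<sigma> "\<lambda>l. \<sigma> (Suc l)" i k M] i neq permutes_inj_on[OF perm]
    by blast
  have kN: "k \<le> N"
    using right[of 0] by auto
  \<comment> \<open>\<open>w\<close> and \<open>w'\<close> are the two sides of
    \<open>v_cyl\<close>, so \<open>v * x = y * v\<close> will hold, while \<open>\<eta>\<close>
    makes \<open>w'\<close> clash with every translate of \<open>w\<close> by at most
    \<open>M\<close>.\<close>
  define w w' where "w = map (\<lambda>l. \<sigma> l (\<eta> l)) [k..<N]" and "w' = map (\<lambda>l. \<sigma> (Suc l) (\<eta> l)) [k..<N]"
  define x y where "x = (shift n S ^^ Suc k) (cylinder S w)" and "y = (shift n S ^^ Suc k) (cylinder S w')"
  have ww: "set w \<subseteq> {1..n}" "set w' \<subseteq> {1..n}"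
    using \<sigma>_in[OF \<eta>] by (auto simp: w_def w'_def)
  have proj: "x * x = x" "star x = x" "y * y = y" "star y = y"
    unfolding x_def y_def star_funpow_shift funpow_shift_mult[symmetric]
    using ww by (simp_all add: cylinder_idem)
  have absorb: "letter (Suc l) (u ! (l - k)) * (shift n S ^^ Suc k) (cylinder S u)
      = (shift n S ^^ Suc k) (cylinder S u)"
    if "l \<ge> k" "l < N" "set u \<subseteq> {1..n}" "length u = N - k" for l u
  proof -
    have "letter (Suc l) (u ! (l - k)) = (shift n S ^^ Suc k) ((shift n S ^^ (l - k)) (cylinder S [u ! (l - k)]))"
      unfolding letter_def using that(1) funpow_add[of "Suc k" "l - k" "shift n S"] by simp
    then show ?thesis
      using that shift_letter_mult_cylinder[of u "l - k"] by (simp only: funpow_shift_mult[symmetric])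
  qed
  have ex: "letter (Suc l) (\<sigma> l (\<eta> l)) * x = x" if "l \<ge> k" "l < N" for l
    using absorb[OF that ww(1)] that by (simp add: x_def w_def)
  have ye: "y * letter (Suc l) (\<sigma> (Suc l) (\<eta> l)) = y" if "l \<ge> k" "l < N" for l
  proof -
    have "letter (Suc l) (\<sigma> (Suc l) (\<eta> l)) * y = y"
      using absorb[OF that ww(2)] that by (simp add: y_def w'_def)
    from arg_cong[OF this, of star] show ?thesis
      by (simp add: star_mult proj letter_def star_funpow_shift del: funpow.simps)
  qed
  \<comment> \<open>If \<open>t\<close> moves the letter of \<open>x\<close> at level
    \<open>Suc l\<close> to level \<open>Suc l'\<close>, where \<open>y\<close> has a different
    letter, then two orthogonal projections meet in the product.\<close>
  have sep: "y * t * x = 0"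
    if "t * letter (Suc l) (\<sigma> l (\<eta> l)) = letter (Suc l') (\<sigma> l (\<eta> l)) * t"
      "l \<ge> k" "l < N" "l' \<ge> k" "l' < N" "\<sigma> l (\<eta> l) \<noteq> \<sigma> (Suc l') (\<eta> l')" for t l l'
  proof -
    have "y * t * x = (y * letter (Suc l') (\<sigma> (Suc l') (\<eta> l'))) * t * (letter (Suc l) (\<sigma> l (\<eta> l)) * x)"
      by (simp add: ex ye that)
    also have "\<dots> = y * (letter (Suc l') (\<sigma> (Suc l') (\<eta> l')) * letter (Suc l') (\<sigma> l (\<eta> l))) * t * x"
      by (metis that(1) mult.assoc)
    also have "\<dots> = 0"
      using letter_mult[OF \<sigma>_in[OF \<eta>] \<sigma>_in[OF \<eta>]] that(6) by (metis mult_zero_left mult_zero_right)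
    finally show ?thesis .
  qed
  have "y * (word S \<mu> * star (word S \<nu>)) * x = 0"
    if \<mu>\<nu>: "\<mu> \<in> words" "\<nu> \<in> words" "length \<mu> \<le> M" "length \<nu> \<le> M" for \<mu> \<nu>
  proof -
    have move: "word S \<mu> * star (word S \<nu>) * letter (Suc l) j
        = letter (Suc l + length \<mu> - length \<nu>) j * (word S \<mu> * star (word S \<nu>))" if "k \<le> l" for l j
      unfolding letter_def using \<mu>\<nu> k that
      by (intro word_pair_mult_shift) (auto simp: words_def)
    show ?thesis
    \<comment> \<open>The longer word decides the direction of the translation, hence whether
      \<open>right\<close> or \<open>left\<close> supplies the clash.\<close>
    proof (cases "length \<nu> \<le> length \<mu>")
      case True
      define m where "m = length \<mu> - length \<nu>"
      have "m \<le> M"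
        using \<mu>\<nu> by (simp add: m_def)
      then obtain l where l: "l \<ge> k" "l + m < N" "\<sigma> l (\<eta> l) \<noteq> \<sigma> (Suc (l + m)) (\<eta> (l + m))"
        using right by blast
      have shift_eq: "Suc l + length \<mu> - length \<nu> = Suc (l + m)"
        using True by (simp add: m_def)
      show ?thesis
        using l by (intro sep[OF move[of l, unfolded shift_eq]]) auto
    next
      case False
      define m where "m = length \<nu> - length \<mu>"
      have "m \<le> M"
        using \<mu>\<nu> by (simp add: m_def)
      then obtain l where l: "l \<ge> k" "l + m < N" "\<sigma> (l + m) (\<eta> (l + m)) \<noteq> \<sigma> (Suc l) (\<eta> l)"
        using left by blast
      have shift_eq: "Suc (l + m) + length \<mu> - length \<nu> = Suc l"
        using False by (simp add: m_def)
      show ?thesis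
        using l by (intro sep[OF move[of "l + m", unfolded shift_eq]]) auto
    qed
  qed
  then have "y * z * x = 0"
    by (intro M) auto
  \<comment> \<open>Compression between \<open>y\<close> and \<open>x\<close> kills \<open>z\<close>
    but leaves \<open>v * x\<close> intact, so \<open>v * x\<close> comes entirely from the error
    \<open>v - z\<close>.\<close>
  moreover have "y * v * x = v * x"
  proof -
    have "v * x = y * v"
      using v_cyl[OF \<eta>, where k = k and L = "N - k"] kN
      by (simp add: x_def y_def w_def w'_def del: funpow.simps)
    then show ?thesis
      by (metis mult.assoc proj(1))
  qed
  ultimately have "v * x = y * (v - z) * x"
    by (simp add: algebra_simps)
  then have "norm x = norm (y * (v - z) * x)"
    using norm_isometry_mult[OF iso, of x] by simp
  also have "\<dots> \<le> norm y * norm (v - z) * norm x"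
    using norm_mult_ineq[of "y * (v - z)" x] norm_mult_ineq[of y "v - z"]
    by (meson mult_right_mono norm_ge_zero order_trans)
  also have "\<dots> \<le> 1 * (1/2) * norm x"
    using norm_projection_le_one[of y] proj vz
    by (intro mult_mono) (auto simp: dist_norm norm_minus_commute)
  finally have "x = 0"
    by simp
  then show False
    using cylinder_nonzero[OF ww(1)] n_ge_2 funpow_shift_eq_0[of "Suc k" "cylinder S w"]
    unfolding x_def by linarith
qed

end


section \<open>Letterwise permutations of words\<close>

fun letterwise :: "(nat \<Rightarrow> nat \<Rightarrow> nat) \<Rightarrow> nat list \<Rightarrow> nat list" where
  "letterwise \<pi> [] = []"
| "letterwise \<pi> (i # \<mu>) = \<pi> 0 i # letterwise (\<lambda>l. \<pi> (Suc l)) \<mu>"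

lemma length_letterwise [simp]: "length (letterwise \<pi> \<mu>) = length \<mu>"
  by (induction \<pi> \<mu> rule: letterwise.induct) auto

lemma letterwise_append:
  "letterwise \<pi> (\<mu> @ \<nu>) = letterwise \<pi> \<mu> @ letterwise (\<lambda>l. \<pi> (length \<mu> + l)) \<nu>"
  by (induction \<pi> \<mu> rule: letterwise.induct) auto

lemma letterwise_letterwise: "letterwise \<pi> (letterwise \<rho> \<mu>) = letterwise (\<lambda>l. \<pi> l \<circ> \<rho> l) \<mu>"
  by (induction \<rho> \<mu> arbitrary: \<pi> rule: letterwise.induct) auto

lemma letterwise_id: "(\<And>l. \<pi> l = id) \<Longrightarrow> letterwise \<pi> \<mu> = \<mu>"
  by (induction \<pi> \<mu> rule: letterwise.induct) auto

lemma letterwise_const: "letterwise (\<lambda>_. \<tau>) \<mu> = map \<tau> \<mu>"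
  by (induction \<mu>) auto

lemma letterwise_in_multi_indices:
  "(\<And>l. \<pi> l permutes {1..n}) \<Longrightarrow> \<mu> \<in> multi_indices n k \<Longrightarrow> letterwise \<pi> \<mu> \<in> multi_indices n k"
proof (induction \<pi> \<mu> arbitrary: k rule: letterwise.induct)
  case (2 \<pi> i \<mu>)
  have "\<pi> 0 i \<in> {1..n}"
    using 2(3) permutes_in_image[OF 2(2)] by (auto simp: multi_indices_def)
  moreover have "letterwise (\<lambda>l. \<pi> (Suc l)) \<mu> \<in> multi_indices n (length \<mu>)"
    using 2 by (auto simp: multi_indices_def)
  ultimately show ?case
    using 2(3) by (auto simp: multi_indices_def)
qed simp

lemma finite_multi_indices: "finite (multi_indices n k)"
  using finite_lists_length_eq[of "{1..n}" k]
  by (auto simp: multi_indices_def elim: rev_finite_subset)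

lemma bij_betw_letterwise:
  assumes "\<And>l. \<pi> l permutes {1..n}"
  shows "bij_betw (letterwise \<pi>) (multi_indices n k) (multi_indices n k)"
proof (rule bij_betw_byWitness[where f' = "letterwise (\<lambda>l. inv_into UNIV (\<pi> l))"])
  show "\<forall>\<mu>\<in>multi_indices n k. letterwise (\<lambda>l. inv_into UNIV (\<pi> l)) (letterwise \<pi> \<mu>) = \<mu>"
    "\<forall>\<mu>\<in>multi_indices n k. letterwise \<pi> (letterwise (\<lambda>l. inv_into UNIV (\<pi> l)) \<mu>) = \<mu>"
    using permutes_inv_o[OF assms] by (auto simp: letterwise_letterwise letterwise_id)
  show "letterwise \<pi> ` multi_indices n k \<subseteq> multi_indices n k"
    "letterwise (\<lambda>l. inv_into UNIV (\<pi> l)) ` multi_indices n k \<subseteq> multi_indices n k"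
    using assms by (auto intro!: letterwise_in_multi_indices permutes_inv)
qed

lemma sum_multi_indices_Suc:
  "(\<Sum>\<mu>\<in>multi_indices n (Suc k). g \<mu>) = (\<Sum>i=1..n. \<Sum>\<mu>\<in>multi_indices n k. g (i # \<mu>))"
proof -
  have "multi_indices n (Suc k) = (\<lambda>(i, \<mu>). i # \<mu>) ` ({1..n} \<times> multi_indices n k)"
    by (auto simp: multi_indices_def length_Suc_conv image_iff)
  moreover have "inj_on (\<lambda>(i, \<mu>). i # \<mu>) ({1..n} \<times> multi_indices n k)"
    by (auto simp: inj_on_def)
  ultimately show ?thesis
    by (simp add: sum.reindex sum.cartesian_product comp_def case_prod_unfold)
qed

section \<open>Permutation unitaries and automorphisms permuting the generators\<close>

context cuntz
begin

lemma sum_cylinder: "(\<Sum>\<mu>\<in>multi_indices n k. cylinder S \<mu>) = 1"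
proof (induction k)
  case 0
  have "multi_indices n 0 = {[]}"
    by (auto simp: multi_indices_def)
  then show ?case
    by simp
next
  case (Suc k)
  have "(\<Sum>\<mu>\<in>multi_indices n (Suc k). cylinder S \<mu>) = shift n S (\<Sum>\<mu>\<in>multi_indices n k. cylinder S \<mu>)"
    by (simp add: sum_multi_indices_Suc shift_def cylinder_Cons sum_distrib_left sum_distrib_right)
  then show ?case
    by (simp add: Suc shift_one)
qed

lemma permutation_unitary_mult_word:
  assumes "\<mu> \<in> multi_indices n k"
  shows "permutation_unitary n S k s * word S \<mu> = word S (s \<mu>)"
proof -
  have "permutation_unitary n S k s * word S \<mu> = (\<Sum>\<nu>\<in>multi_indices n k. if \<nu> = \<mu> then word S (s \<nu>) else 0)"
    unfolding permutation_unitary_def sum_distrib_right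
    by (intro sum.cong refl) (use assms in \<open>auto simp: mult.assoc orthogonal_words multi_indices_def\<close>)
  then show ?thesis
    using assms finite_multi_indices by simp
qed

lemma star_permutation_unitary_mult_word:
  assumes s: "bij_betw s (multi_indices n k) (multi_indices n k)" and "\<mu> \<in> multi_indices n k"
  shows "star (permutation_unitary n S k s) * word S (s \<mu>) = word S \<mu>"
proof -
  have in': "s \<nu> \<in> multi_indices n k" if "\<nu> \<in> multi_indices n k" for \<nu>
    using that s bij_betwE by blast
  have "star (permutation_unitary n S k s) * word S (s \<mu>)
      = (\<Sum>\<nu>\<in>multi_indices n k. word S \<nu> * (star (word S (s \<nu>)) * word S (s \<mu>)))"
    unfolding permutation_unitary_def star_sum sum_distrib_right
    by (simp add: star_mult star_star mult.assoc)
  also have "\<dots> = (\<Sum>\<nu>\<in>multi_indices n k. if \<nu> = \<mu> then word S \<nu> else 0)"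
  proof (intro sum.cong refl)
    fix \<nu> assume \<nu>: "\<nu> \<in> multi_indices n k"
    have "star (word S (s \<nu>)) * word S (s \<mu>) = (if s \<nu> = s \<mu> then 1 else 0)"
      using in'[OF \<nu>] in'[OF assms(2)] by (intro orthogonal_words) (auto simp: multi_indices_def)
    moreover have "s \<nu> = s \<mu> \<longleftrightarrow> \<nu> = \<mu>"
      using \<nu> assms(2) s by (auto simp: bij_betw_def inj_on_eq_iff)
    ultimately show "word S \<nu> * (star (word S (s \<nu>)) * word S (s \<mu>)) = (if \<nu> = \<mu> then word S \<nu> else 0)"
      by simp
  qed
  also have "\<dots> = word S \<mu>"
    using assms finite_multi_indices by simp
  finally show ?thesis .
qed

lemma permutation_unitary_unitary:
  assumes s: "bij_betw s (multi_indices n k) (multi_indices n k)"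
  defines "u \<equiv> permutation_unitary n S k s"
  shows "star u * u = 1" "u * star u = 1"
proof -
  have "star u * u = (\<Sum>\<mu>\<in>multi_indices n k. star u * word S (s \<mu>) * star (word S \<mu>))"
    unfolding u_def permutation_unitary_def[of n S k s] by (simp add: sum_distrib_left mult.assoc)
  also have "\<dots> = (\<Sum>\<mu>\<in>multi_indices n k. cylinder S \<mu>)"
    by (intro sum.cong) (auto simp: u_def star_permutation_unitary_mult_word[OF s] cylinder_def)
  finally show "star u * u = 1"
    by (simp add: sum_cylinder)
  have "u * star u = (\<Sum>\<mu>\<in>multi_indices n k. u * word S \<mu> * star (word S (s \<mu>)))"
    unfolding u_def permutation_unitary_def[of n S k s]
    by (simp add: star_sum star_mult star_star sum_distrib_left mult.assoc)
  also have "\<dots> = (\<Sum>\<mu>\<in>multi_indices n k. cylinder S (s \<mu>))"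
    by (intro sum.cong) (auto simp: u_def permutation_unitary_mult_word cylinder_def)
  also have "\<dots> = (\<Sum>\<mu>\<in>multi_indices n k. cylinder S \<mu>)"
    by (rule sum.reindex_bij_betw[OF s])
  finally show "u * star u = 1"
    by (simp add: sum_cylinder)
qed

text \<open>A unitary of level \<open>k\<close> acts on the first \<open>k\<close> letters only; as
  \<open>\<pi>\<close> is trivial from position \<open>k\<close> on, this is the full letterwise
  action on longer words too.\<close>

lemma permutation_unitary_mult_long_word:
  assumes \<mu>: "\<mu> \<in> words" "k \<le> length \<mu>" and \<pi>: "\<And>l. l \<ge> k \<Longrightarrow> \<pi> l = id"
  shows "permutation_unitary n S k (letterwise \<pi>) * word S \<mu> = word S (letterwise \<pi> \<mu>)"
proof -
  have take: "take k \<mu> \<in> multi_indices n k"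
    using \<mu> set_take_subset[of k \<mu>] by (auto simp: multi_indices_def words_def)
  have "permutation_unitary n S k (letterwise \<pi>) * word S (take k \<mu> @ drop k \<mu>)
      = word S (letterwise \<pi> (take k \<mu>) @ drop k \<mu>)"
    unfolding word_append mult.assoc[symmetric] permutation_unitary_mult_word[OF take] ..
  also have "letterwise \<pi> (take k \<mu>) @ drop k \<mu> = letterwise \<pi> (take k \<mu> @ drop k \<mu>)"
    unfolding letterwise_append using \<mu>(2) by (simp add: letterwise_id \<pi>)
  finally show ?thesis
    by simp
qed

text \<open>The universal property gives endomorphisms for \<open>\<tau>\<close> and for its
  inverse; both composites fix the generators, hence are the identity.\<close>

lemma bogoliubov_automorphism:
  assumes \<tau>: "\<tau> permutes {1..n}"
  shows "\<exists>\<beta>. automorphism \<beta> \<and> (\<forall>i\<in>{1..n}. \<beta> (S i) = S (\<tau> i))"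
proof -
  have ex: "\<exists>\<beta>. endomorphism \<beta> \<and> (\<forall>i\<in>{1..n}. \<beta> (S i) = S (\<tau> i))" if \<tau>: "\<tau> permutes {1..n}" for \<tau>
  proof (rule endomorphism_exists)
    show "star (S (\<tau> i)) * S (\<tau> i) = 1" if "i \<in> {1..n}" for i
      using that permutes_in_image[OF \<tau>] isometry by blast
    show "(\<Sum>i=1..n. S (\<tau> i) * star (S (\<tau> i))) = 1"
      using sum.permute[OF \<tau>, of "\<lambda>i. S i * star (S i)"] sum_range_projections
      by (simp add: comp_def)
  qed
  obtain \<beta> where \<beta>: "endomorphism \<beta>" "\<And>i. i \<in> {1..n} \<Longrightarrow> \<beta> (S i) = S (\<tau> i)"
    using ex[OF \<tau>] by blast
  obtain \<gamma> where \<gamma>: "endomorphism \<gamma>" "\<And>i. i \<in> {1..n} \<Longrightarrow> \<gamma> (S i) = S (inv_into UNIV \<tau> i)"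
    using ex[OF permutes_inv[OF \<tau>]] by blast
  have id: "endomorphism (\<lambda>x. x)" and comp: "endomorphism (\<lambda>x. \<beta> (\<gamma> x))" "endomorphism (\<lambda>x. \<gamma> (\<beta> x))"
    using \<beta>(1) \<gamma>(1) by (auto simp: unital_star_hom_on_def)
  have "(\<lambda>x. \<beta> (\<gamma> x)) = (\<lambda>x. x)"
    using permutes_in_image[OF permutes_inv[OF \<tau>]] \<beta>(2) \<gamma>(2) permutes_inverses(1)[OF \<tau>]
    by (intro endomorphism_eqI comp id) simp
  moreover have "(\<lambda>x. \<gamma> (\<beta> x)) = (\<lambda>x. x)"
    using permutes_in_image[OF \<tau>] \<beta>(2) \<gamma>(2) permutes_inverses(2)[OF \<tau>]
    by (intro endomorphism_eqI comp id) simp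
  ultimately have "bij \<beta>"
    by (intro o_bij[of \<gamma>]) (auto simp: fun_eq_iff)
  then show ?thesis
    using \<beta> by (auto simp: star_automorphism_on_def)
qed

end

lemma automorphism_conjugate:
  fixes \<beta> :: "'a::cstar_algebra \<Rightarrow> 'a"
  assumes \<beta>: "automorphism \<beta>" and u: "star u * u = 1" "u * star u = 1"
  shows "automorphism (\<lambda>x. u * \<beta> x * star u)"
proof -
  have cancel: "star u * (u * x) = x" "u * (star u * x) = x" for x
    using u by (simp_all flip: mult.assoc)
  have "endomorphism (\<lambda>x. u * \<beta> x * star u)"
    using \<beta> by (auto simp: star_automorphism_on_def unital_star_hom_on_def star_mult star_star
        distrib_left distrib_right mult_scaleC_left mult_scaleC_right mult.assoc cancel u)
  moreover have "bij (\<lambda>y. u * y * star u)"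
    by (rule o_bij[of "\<lambda>y. star u * y * u"]) (auto simp: fun_eq_iff mult.assoc cancel u)
  then have "bij (\<lambda>x. u * \<beta> x * star u)"
    using \<beta> bij_comp[of \<beta> "\<lambda>y. u * y * star u"] by (simp add: star_automorphism_on_def comp_def)
  ultimately show ?thesis
    by (simp add: star_automorphism_on_def)
qed


section \<open>Eventually identical automorphisms extend\<close>

context product_type
begin

text \<open>A shifted cylinder is a product of letters at levels \<open>k\<close>,
  \<open>k + 1\<close> and so on, each permuted according to its level. The depth \<open>k\<close>
  is general because the induction increases it.\<close>

lemma hom_cylinder:
  assumes \<sigma>: "\<And>k. level_permutation n S \<alpha> k (\<sigma> k)" and "\<mu> \<in> words"
  shows "\<alpha> ((shift n S ^^ k) (cylinder S \<mu>))
    = (shift n S ^^ k) (cylinder S (letterwise (\<lambda>l. \<sigma> (k + l)) \<mu>))"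
  using assms(2)
proof (induction \<mu> arbitrary: k)
  case Nil
  then show ?case
    by (simp add: funpow_shift_one hom_one)
next
  case (Cons i \<mu>)
  have i: "i \<in> {1..n}" and \<mu>: "\<mu> \<in> words"
    using Cons.prems by (auto simp: words_def)
  have \<sigma>i: "\<sigma> k i \<in> {1..n}" "\<alpha> (letter k i) = letter k (\<sigma> k i)"
    using \<sigma>[of k] i permutes_in_image[of "\<sigma> k" "{1..n}" i] by (auto simp: level_permutation_iff)
  have "\<alpha> ((shift n S ^^ k) (cylinder S (i # \<mu>)))
      = \<alpha> (letter k i) * \<alpha> ((shift n S ^^ Suc k) (cylinder S \<mu>))"
    unfolding funpow_shift_cylinder_Cons[OF i]
    by (intro hom_mult letter_in_diagonal i funpow_shift_cylinder_in_diagonal \<mu>)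
  also have "\<dots> = letter k (\<sigma> k i) * (shift n S ^^ Suc k) (cylinder S (letterwise (\<lambda>l. \<sigma> (Suc k + l)) \<mu>))"
    unfolding Cons.IH[OF \<mu>] \<sigma>i(2) ..
  also have "\<dots> = (shift n S ^^ k) (cylinder S (\<sigma> k i # letterwise (\<lambda>l. \<sigma> (Suc k + l)) \<mu>))"
    by (rule funpow_shift_cylinder_Cons[OF \<sigma>i(1), symmetric])
  finally show ?case
    by simp
qed

text \<open>A unitary of finite level is controlled on long words only. Short cylinders are sums of
  longer ones, after which linearity and continuity reach the whole diagonal.\<close>

lemma extendsI:
  assumes f: "endomorphism f" and eq: "\<And>\<mu>. \<mu> \<in> words \<Longrightarrow> K \<le> length \<mu> \<Longrightarrow> f (cylinder S \<mu>) = \<alpha> (cylinder S \<mu>)"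
  shows "extends n S \<alpha> f"
proof -
  have f': "\<And>x y. f (x + y) = f x + f y" "\<And>c x. f (c *\<^sub>C x) = c *\<^sub>C f x"
    using f by (auto simp: unital_star_hom_on_def)
  have f0: "f 0 = 0"
    using f'(2)[of 0 0] by simp
  have f_sum: "f (\<Sum>i\<in>I. g i) = (\<Sum>i\<in>I. f (g i))" for g and I :: "nat set"
    by (induction I rule: infinite_finite_induct) (auto simp: f' f0)
  have cyl_D: "cylinder S \<mu> \<in> diagonal n S" if "\<mu> \<in> words" for \<mu>
    using funpow_shift_cylinder_in_diagonal[OF that, of 0] by simp
  \<comment> \<open>\<open>d\<close> bounds how many letters \<open>\<mu>\<close> falls short of
    \<open>K\<close>, and each step of the induction splits off one more letter;
    \<open>d = K\<close> covers every word.\<close>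
  have cyl: "f (cylinder S \<mu>) = \<alpha> (cylinder S \<mu>)" if "\<mu> \<in> words" "K \<le> length \<mu> + d" for \<mu> d
    using that
  proof (induction d arbitrary: \<mu>)
    case (Suc d)
    have w: "\<mu> @ [i] \<in> words" if "i \<in> {1..n}" for i
      using that Suc.prems by (auto simp: words_def)
    have "f (cylinder S \<mu>) = (\<Sum>i=1..n. f (cylinder S (\<mu> @ [i])))"
      unfolding cylinder_split[of \<mu>] by (rule f_sum)
    also have "\<dots> = (\<Sum>i=1..n. \<alpha> (cylinder S (\<mu> @ [i])))"
      using Suc by (intro sum.cong refl Suc.IH w) auto
    also have "\<dots> = \<alpha> (cylinder S \<mu>)"
      unfolding cylinder_split[of \<mu>] using cyl_D[OF w] by (intro hom_sum[symmetric]) auto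
    finally show ?case .
  qed (use eq in simp)
  have span: "x \<in> diagonal n S \<and> f x = \<alpha> x" if "x \<in> cspan (cylinder S ` words)" for x
    using that
  proof (induction rule: complex_vector.span_induct_alt)
    case base
    then show ?case
      by (simp add: f0 hom_zero cstar_subalgebraD(7)[OF cstar_subalgebra_diagonal])
  next
    case (step c x y)
    then obtain \<mu> where \<mu>: "x = cylinder S \<mu>" "\<mu> \<in> words"
      by blast
    then show ?case
      using step cyl[of \<mu> K] cyl_D[of \<mu>]
      by (simp add: f' hom_add hom_scaleC cstar_subalgebraD(3,5)[OF cstar_subalgebra_diagonal])
  qed
  have "f x = \<alpha> x" if x: "x \<in> diagonal n S" for x
  proof -
    obtain s where s: "\<And>m. s m \<in> cspan (cylinder S ` words)" "s \<longlonglongrightarrow> x"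
      using x unfolding diagonal_eq closure_sequential by blast
    have "(\<lambda>m. f (s m)) \<longlonglongrightarrow> f x"
      using s(2) by (intro continuous_on_tendsto_compose[OF star_hom_continuous_on[OF cstar_subalgebra_UNIV f]]) auto
    moreover have "(\<lambda>m. \<alpha> (s m)) \<longlonglongrightarrow> \<alpha> x"
      using s x cspan_cylinder_subset_diagonal
      by (intro continuous_on_tendsto_compose[OF star_hom_continuous_on[OF cstar_subalgebra_diagonal hom]])
        (auto intro!: always_eventually)
    ultimately show ?thesis
      using span[OF s(1)] LIMSEQ_unique by auto
  qed
  then show ?thesis
    by (simp add: extends_def)
qed

lemma eventually_identical_imp_extension:
  assumes \<sigma>: "\<And>k. level_permutation n S \<alpha> k (\<sigma> k)" and K: "\<And>k. k \<ge> K \<Longrightarrow> \<sigma> k = \<sigma> K"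
  shows "\<exists>f. permutation_automorphism n S f \<and> extends n S \<alpha> f"
proof -
  have perm: "\<sigma> k permutes {1..n}" for k
    using \<sigma> by (simp add: level_permutation_iff)
  define \<tau> where "\<tau> = \<sigma> K"
  have \<tau>: "\<tau> permutes {1..n}"
    by (simp add: \<tau>_def perm)
  \<comment> \<open>\<open>\<rho>\<close> is the correction remaining after \<open>\<tau>\<close>
    has acted on every letter, trivial from \<open>K\<close> on. \<open>\<kappa>\<close> describes
    the unitary taking \<open>S i\<close> to \<open>u * S (\<tau> i) * star u\<close>: the first
    letter is changed by \<open>\<sigma> 0\<close>, and the letter at position \<open>Suc j\<close>
    by \<open>\<rho> (Suc j)\<close> after the inverse of \<open>\<rho> j\<close>, where
    \<open>\<tau>\<close> cancels.\<close>
  define \<rho> where "\<rho> l = \<sigma> l \<circ> inv_into UNIV \<tau>" for l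
  define \<kappa> where "\<kappa> l = (case l of 0 \<Rightarrow> \<sigma> 0 | Suc j \<Rightarrow> \<sigma> (Suc j) \<circ> inv_into UNIV (\<sigma> j))" for l
  have \<rho>: "\<rho> l permutes {1..n}" for l
    unfolding \<rho>_def by (intro permutes_compose permutes_inv \<tau> perm)
  have \<kappa>: "\<kappa> l permutes {1..n}" for l
    unfolding \<kappa>_def by (cases l) (auto intro!: permutes_compose permutes_inv perm)
  have \<rho>_id: "\<rho> l = id" if "l \<ge> K" for l
    using K[OF that] permutes_inv_o(1)[OF \<tau>] by (simp add: \<rho>_def \<tau>_def)
  have \<rho>\<tau>: "\<rho> l \<circ> \<tau> = \<sigma> l" for l
    using permutes_inv_o(2)[OF \<tau>] by (simp add: \<rho>_def comp_assoc)
  have \<kappa>\<rho>: "\<kappa> (Suc l) \<circ> \<rho> l = \<rho> (Suc l)" for l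
  proof -
    have "inv_into UNIV (\<sigma> l) \<circ> (\<sigma> l \<circ> inv_into UNIV \<tau>) = inv_into UNIV \<tau>"
      using permutes_inv_o(2)[OF perm] by (simp flip: comp_assoc)
    then show ?thesis
      by (simp add: \<kappa>_def \<rho>_def comp_assoc)
  qed
  define u where "u = permutation_unitary n S K (letterwise \<rho>)"
  have u: "star u * u = 1" "u * star u = 1"
    unfolding u_def by (intro permutation_unitary_unitary bij_betw_letterwise \<rho>)+
  obtain \<beta> where \<beta>: "automorphism \<beta>" "\<And>i. i \<in> {1..n} \<Longrightarrow> \<beta> (S i) = S (\<tau> i)"
    using bogoliubov_automorphism[OF \<tau>] by blast
  have \<beta>': "\<beta> 1 = 1" "\<And>x y. \<beta> (x * y) = \<beta> x * \<beta> y" "\<And>x. \<beta> (star x) = star (\<beta> x)"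
    using \<beta>(1) by (auto simp: star_automorphism_on_def unital_star_hom_on_def)
  have \<beta>_word: "\<beta> (word S \<mu>) = word S (map \<tau> \<mu>)" if "\<mu> \<in> words" for \<mu>
    using that by (induction \<mu>) (auto simp: words_def \<beta>' \<beta>(2))
  define f where "f x = u * \<beta> x * star u" for x
  have aut: "automorphism f"
    unfolding f_def by (rule automorphism_conjugate[OF \<beta>(1) u])
  have \<tau>_words: "map \<tau> \<mu> \<in> words" if "\<mu> \<in> words" for \<mu>
    using that permutes_in_image[OF \<tau>] by (auto simp: words_def)
  have "f (cylinder S \<mu>) = \<alpha> (cylinder S \<mu>)" if \<mu>: "\<mu> \<in> words" "K \<le> length \<mu>" for \<mu>
  proof -
    have "u * \<beta> (word S \<mu>) = word S (letterwise \<rho> (map \<tau> \<mu>))"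
      unfolding u_def \<beta>_word[OF \<mu>(1)] using \<mu> \<rho>_id
      by (intro permutation_unitary_mult_long_word \<tau>_words) auto
    also have "letterwise \<rho> (map \<tau> \<mu>) = letterwise \<sigma> \<mu>"
      unfolding letterwise_const[symmetric] letterwise_letterwise \<rho>\<tau> ..
    finally have "f (cylinder S \<mu>) = word S (letterwise \<sigma> \<mu>) * star (word S (letterwise \<sigma> \<mu>))"
      unfolding f_def cylinder_def \<beta>' by (metis mult.assoc star_mult)
    then show ?thesis
      using hom_cylinder[OF \<sigma> \<mu>(1), of 0] by (simp add: cylinder_def)
  qed
  then have ext: "extends n S \<alpha> f"
    using aut by (intro extendsI[of f K]) (auto simp: star_automorphism_on_def)
  \<comment> \<open>The level is \<open>Suc K\<close>: one letter for \<open>S i\<close> and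
    \<open>K\<close> letters for \<open>star u\<close>. Off the multi-indices \<open>s\<close> is
    the identity, as \<open>permutes\<close> requires.\<close>
  define s where "s \<mu> = (if \<mu> \<in> multi_indices n (Suc K) then letterwise \<kappa> \<mu> else \<mu>)" for \<mu>
  have s: "s permutes multi_indices n (Suc K)"
  proof (rule bij_imp_permutes)
    show "bij_betw s (multi_indices n (Suc K)) (multi_indices n (Suc K))"
      using bij_betw_letterwise[OF \<kappa>] by (rule bij_betw_cong[THEN iffD1, rotated]) (simp add: s_def)
  qed (simp add: s_def)
  have "f (S i) = permutation_unitary n S (Suc K) s * S i" if i: "i \<in> {1..n}" for i
  proof -
    have "permutation_unitary n S (Suc K) s * S i
        = (\<Sum>j=1..n. \<Sum>\<mu>\<in>multi_indices n K. word S (s (j # \<mu>)) * star (word S \<mu>) * (star (S j) * S i))"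
      by (simp add: permutation_unitary_def sum_multi_indices_Suc sum_distrib_right star_mult mult.assoc)
    also have "\<dots> = (\<Sum>j=1..n. if j = i then \<Sum>\<mu>\<in>multi_indices n K. word S (s (j # \<mu>)) * star (word S \<mu>) else 0)"
      using i by (intro sum.cong refl) (simp add: star_S_mult_S)
    also have "\<dots> = (\<Sum>\<mu>\<in>multi_indices n K. word S (s (i # \<mu>)) * star (word S \<mu>))"
      using i by simp
    also have "\<dots> = (\<Sum>\<mu>\<in>multi_indices n K. word S (letterwise \<kappa> (i # \<mu>)) * star (word S \<mu>))"
      using i by (intro sum.cong refl) (auto simp: s_def multi_indices_def)
    \<comment> \<open>Reindexing by \<open>letterwise \<rho>\<close> turns the right-hand factors
      into those occurring in \<open>star u\<close>.\<close>
    also have "\<dots> = (\<Sum>\<nu>\<in>multi_indices n K. word S (letterwise \<kappa> (i # letterwise \<rho> \<nu>)) * star (word S (letterwise \<rho> \<nu>)))"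
      by (rule sum.reindex_bij_betw[OF bij_betw_letterwise[OF \<rho>], symmetric])
    also have "\<dots> = (\<Sum>\<nu>\<in>multi_indices n K. u * word S (\<tau> i # \<nu>) * star (word S (letterwise \<rho> \<nu>)))"
    proof (intro sum.cong refl)
      fix \<nu> assume \<nu>: "\<nu> \<in> multi_indices n K"
      have "\<tau> i # \<nu> \<in> words" "K \<le> length (\<tau> i # \<nu>)"
        using \<nu> i permutes_in_image[OF \<tau>] by (auto simp: words_def multi_indices_def)
      \<comment> \<open>The word has \<open>Suc K\<close> letters, one more than the level of
        \<open>u\<close>; at the last position \<open>K\<close> the correction \<open>\<rho>\<close>
        is trivial.\<close>
      then have "u * word S (\<tau> i # \<nu>) = word S (letterwise \<rho> (\<tau> i # \<nu>))"
        unfolding u_def using \<rho>_id by (intro permutation_unitary_mult_long_word) auto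
      also have "letterwise \<rho> (\<tau> i # \<nu>) = letterwise \<kappa> (i # letterwise \<rho> \<nu>)"
        using fun_cong[OF \<rho>\<tau>, of 0 i] by (simp add: letterwise_letterwise \<kappa>\<rho>) (simp add: \<kappa>_def)
      finally show "word S (letterwise \<kappa> (i # letterwise \<rho> \<nu>)) * star (word S (letterwise \<rho> \<nu>))
          = u * word S (\<tau> i # \<nu>) * star (word S (letterwise \<rho> \<nu>))"
        by simp
    qed
    also have "\<dots> = u * S (\<tau> i) * star u"
      by (simp add: u_def permutation_unitary_def star_sum star_mult star_star sum_distrib_left mult.assoc)
    finally show ?thesis
      by (simp add: f_def \<beta>(2)[OF i])
  qed
  then have "is_lambda n S (permutation_unitary n S (Suc K) s) f"
    using aut by (simp add: is_lambda_def star_automorphism_on_def)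
  then have "permutation_automorphism n S f"
    unfolding permutation_automorphism_def using aut s by (metis One_nat_def Suc_le_mono zero_le)
  then show ?thesis
    using ext by blast
qed

end

text \<open>The uniqueness clause makes eventual identity a property of \<alpha> alone, independent
  of chosen permutations. Extension to an endomorphism follows from extension to a permutation
  automorphism, which is in particular an endomorphism.\<close>

theorem proposition3p1:
  fixes n :: nat and S :: "nat \<Rightarrow> 'a::cstar_algebra" and \<alpha> :: "'a \<Rightarrow> 'a"
  assumes "n \<ge> 2"
    and "cuntz_algebra n S"
    and "product_type_automorphism n S \<alpha>"
  shows "(\<forall>k. \<exists>!\<sigma>. level_permutation n S \<alpha> k \<sigma>) \<and>
    ((\<exists>f. endomorphism f \<and> extends n S \<alpha> f) \<longleftrightarrow> eventually_identical n S \<alpha>) \<and>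
    (eventually_identical n S \<alpha> \<longrightarrow>
       (\<exists>f. permutation_automorphism n S f \<and> extends n S \<alpha> f))"
proof -
  interpret product_type n S \<alpha>
    using assms by unfold_locales
  obtain \<sigma> where \<sigma>: "\<And>k. level_permutation n S \<alpha> k (\<sigma> k)"
    using level_permutation_exists by metis
  have "eventually_identical n S \<alpha>" if f: "endomorphism f" "extends n S \<alpha> f" for f
  proof -
    obtain K where K: "\<And>k. k \<ge> K \<Longrightarrow> \<sigma> (Suc k) = \<sigma> k"
      using extendible_imp_eventually_constant[OF f \<sigma>] by blast
    have "\<sigma> k = \<sigma> K" if "k \<ge> K" for k
      using that by (induction rule: dec_induct) (auto simp: K)
    then show ?thesis
      unfolding eventually_identical_def using \<sigma> by blast
  qed
  moreover have ext: "\<exists>f. permutation_automorphism n S f \<and> extends n S \<alpha> f" if "eventually_identical n S \<alpha>"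
    using that eventually_identical_imp_extension unfolding eventually_identical_def by metis
  moreover have "endomorphism f" if "permutation_automorphism n S f" for f
    using that by (simp add: permutation_automorphism_def star_automorphism_on_def)
  ultimately show ?thesis
    using level_permutation_ex1 by blast
qed

end
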